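(* Let $A$ and $B$ be $n\times n$ positive definite matrices and let $0\le t\le 1$. Then for every unitarily invariant norm $|||\cdot|||$ on the space of $n\times n$ matrices, $$\begin{aligned} |||A\#_{t}B|||&\leq |||e^{(1-t)\log A+t \log B}|||\\ &\leq |||B^{\frac{t}{2}} A^{1-t} B^{\frac{t}{2}}|||\\ &\leq \left|\left|\left|\tfrac{1}{2}\left(A^{1-t} B^{t}+ B^{t} A^{1-t}\right)\right|\right|\right|\\ &\leq |||A^{1-t} B^t|||\\ &\leq |||(1-t)A+tB|||. \end{aligned}$$
   Context: Matrices are $n\times n$ (complex), and positive definite matrices are Hermitian. Real powers and logarithms of positive definite matrices are defined by the usual functional calculus. For $0\le t\le 1$ the $t$-geometric mean of positive definite $A,B$ is $A\#_tB=A^{1/2}\left(A^{-1/2}BA^{-1/2}\right)^tA^{1/2}$. A norm $|||\cdot|||$ on $n\times n$ matrices is unitarily invariant if $|||UXV|||=|||X|||$ for all matrices $X$ and all unitary $U,V$. *)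

theory Defs
  imports "HOL-Analysis.Analysis"
begin

definition adj :: "complex^'n^'n \<Rightarrow> complex^'n^'n"
  where "adj A = (\<chi> i j. cnj (A $ j $ i))"

definition hermitian :: "complex^'n^'n \<Rightarrow> bool"
  where "hermitian A \<longleftrightarrow> adj A = A"

definition unitary :: "complex^'n^'n \<Rightarrow> bool"
  where "unitary U \<longleftrightarrow> adj U ** U = mat 1 \<and> U ** adj U = mat 1"

text \<open>For Hermitian \<open>A\<close> the quadratic form is real, so taking its real part loses nothing.\<close>

definition pos_def :: "complex^'n^'n \<Rightarrow> bool"
  where "pos_def A \<longleftrightarrow>
    hermitian A \<and> (\<forall>x. x \<noteq> 0 \<longrightarrow> Re (\<Sum>i\<in>UNIV. cnj (x $ i) * (A *v x) $ i) > 0)"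

definition real_diag :: "('n \<Rightarrow> real) \<Rightarrow> complex^'n^'n"
  where "real_diag d = (\<chi> i j. if i = j then complex_of_real (d i) else 0)"

text \<open>Functional calculus \<open>f(A) = U diag(f(d\<^sub>i)) U*\<close> for a spectral decomposition
  \<open>A = U diag(d\<^sub>i) U*\<close> of a Hermitian matrix; the value does not depend on the decomposition
  (\<open>mat_fun_eq\<close>). It is unspecified for non-Hermitian arguments.\<close>

definition mat_fun :: "(real \<Rightarrow> real) \<Rightarrow> complex^'n^'n \<Rightarrow> complex^'n^'n"
  where "mat_fun f A =
    (THE X. \<exists>U d. unitary U \<and> A = U ** real_diag d ** adj U
      \<and> X = U ** real_diag (\<lambda>i. f (d i)) ** adj U)"

definition mat_powr :: "complex^'n^'n \<Rightarrow> real \<Rightarrow> complex^'n^'n"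
  where "mat_powr A s = mat_fun (\<lambda>x. x powr s) A"

definition mat_ln :: "complex^'n^'n \<Rightarrow> complex^'n^'n"
  where "mat_ln A = mat_fun ln A"

text \<open>The type \<^typ>\<open>complex^'n^'n\<close> carries the componentwise product, so the
  exponential series is written out with the powers of the matrix product.\<close>

definition mat_exp :: "complex^'n^'n \<Rightarrow> complex^'n^'n"
  where "mat_exp A = (\<Sum>k. (1 / fact k) *\<^sub>R (((**) A ^^ k) (mat 1)))"

definition geo_mean :: "complex^'n^'n \<Rightarrow> real \<Rightarrow> complex^'n^'n \<Rightarrow> complex^'n^'n"
  where "geo_mean A t B =
    mat_powr A (1/2) ** mat_powr (mat_powr A (-1/2) ** B ** mat_powr A (-1/2)) t ** mat_powr A (1/2)"

definition is_matrix_norm :: "(complex^'n^'n \<Rightarrow> real) \<Rightarrow> bool"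
  where "is_matrix_norm N \<longleftrightarrow>
    (\<forall>X. N X \<ge> 0) \<and> (\<forall>X. N X = 0 \<longleftrightarrow> X = 0) \<and>
    (\<forall>c X. N (\<chi> i j. c * X $ i $ j) = cmod c * N X) \<and>
    (\<forall>X Y. N (X + Y) \<le> N X + N Y)"

definition unitarily_invariant_norm :: "(complex^'n^'n \<Rightarrow> real) \<Rightarrow> bool"
  where "unitarily_invariant_norm N \<longleftrightarrow>
    is_matrix_norm N \<and> (\<forall>U X V. unitary U \<longrightarrow> unitary V \<longrightarrow> N (U ** X ** V) = N X)"

lemma real_diag_intertwine:
  fixes W :: "complex^'n^'n"
  assumes "W ** real_diag d = real_diag e ** W"
  shows "W ** real_diag (\<lambda>i. f (d i)) = real_diag (\<lambda>i. f (e i)) ** W"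
proof -
  have R: "(M ** real_diag g) $ i $ j = M $ i $ j * complex_of_real (g j)"
    for M :: "complex^'n^'n" and g i j
    by (simp add: matrix_matrix_mult_def real_diag_def if_distrib cong: if_cong)
  have L: "(real_diag g ** M) $ i $ j = complex_of_real (g i) * M $ i $ j"
    for M :: "complex^'n^'n" and g i j
    by (simp add: matrix_matrix_mult_def real_diag_def if_distrib if_distribR cong: if_cong)
  have "W $ i $ j * complex_of_real (f (d j)) = complex_of_real (f (e i)) * W $ i $ j" for i j
  proof -
    have "W $ i $ j * complex_of_real (d j) = complex_of_real (e i) * W $ i $ j"
      using arg_cong[OF assms, of "\<lambda>M. M $ i $ j"] by (simp only: R L)
    then show ?thesis by (cases "W $ i $ j = 0") auto
  qed
  then show ?thesis by (simp add: vec_eq_iff R L)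
qed

lemma mat_fun_eq:
  assumes "unitary U" and "A = U ** real_diag d ** adj U"
  shows "mat_fun f A = U ** real_diag (\<lambda>i. f (d i)) ** adj U"
  unfolding mat_fun_def
proof (rule the_equality)
  show "\<exists>V e. unitary V \<and> A = V ** real_diag e ** adj V
      \<and> U ** real_diag (\<lambda>i. f (d i)) ** adj U = V ** real_diag (\<lambda>i. f (e i)) ** adj V"
    using assms by blast
next
  fix X
  assume "\<exists>V e. unitary V \<and> A = V ** real_diag e ** adj V
      \<and> X = V ** real_diag (\<lambda>i. f (e i)) ** adj V"
  then obtain V e where V: "unitary V" "A = V ** real_diag e ** adj V"
    and X: "X = V ** real_diag (\<lambda>i. f (e i)) ** adj V" by blast
  let ?W = "adj U ** V"
  have u: "adj U ** U = mat 1" "U ** adj U = mat 1" "adj V ** V = mat 1" "V ** adj V = mat 1"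
    using assms V by (auto simp: unitary_def)
  have "?W ** real_diag e = adj U ** (V ** real_diag e ** adj V) ** V"
    by (metis matrix_mul_assoc matrix_mul_rid u(3))
  also have "\<dots> = adj U ** (U ** real_diag d ** adj U) ** V"
    using assms(2) V(2) by simp
  also have "\<dots> = real_diag d ** ?W"
    by (metis matrix_mul_assoc matrix_mul_lid u(1))
  finally have "?W ** real_diag (\<lambda>i. f (e i)) = real_diag (\<lambda>i. f (d i)) ** ?W"
    by (rule real_diag_intertwine)
  then have "U ** (?W ** real_diag (\<lambda>i. f (e i))) ** adj V
      = U ** (real_diag (\<lambda>i. f (d i)) ** ?W) ** adj V"
    by simp
  then have "(U ** adj U) ** V ** real_diag (\<lambda>i. f (e i)) ** adj V
      = U ** real_diag (\<lambda>i. f (d i)) ** adj U ** (V ** adj V)"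
    by (simp add: matrix_mul_assoc)
  then show "X = U ** real_diag (\<lambda>i. f (d i)) ** adj U"
    by (simp add: u X)
qed

end

theory Submission
  imports Defs
begin

text \<open>Write \<open>L = (1-t) log A + t log B\<close>. All comparisons of spectra are made through the sums
  \<open>\<Sum>\<^sub>i (\<lambda>\<^sub>i - c)\<^sup>+\<close>, taken for the logarithms of the eigenvalues in the first two inequalities.
  If these sums are ordered for every \<open>c\<close>, a separating hyperplane puts one spectrum
  below a convex combination of permutations of the other, and the norms are ordered.

  The log-majorizations avoid exterior powers: instead of compressing to top eigenvectors, a matrix is
  cut down to a smaller one for which the operator inequality with bound \<open>1\<close> applies, and the loss is measured
  by log-determinants. Shifts by \<open>c\<close> come from scaling \<open>A\<close> and \<open>B\<close>. For the geometric mean one doubles the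
  exponents and compares \<open>A\<^sup>r #\<^sub>t B\<^sup>r \<le> (1-t) A\<^sup>r + t B\<^sup>r = 1 + r L + o(r)\<close> as \<open>r = 2\<^bsup>-m\<^esup>\<close> tends to \<open>0\<close>;
  for the product \<open>B\<^bsup>t/2\<^esup> A\<^bsup>1-t\<^esup> B\<^bsup>t/2\<^esup>\<close> one uses that the logarithm is operator monotone.

  The third inequality holds because \<open>X S + S X \<mapsto> S\<^bsup>1/2\<^esup> X S\<^bsup>1/2\<^esup>\<close> is, up to a factor \<open>2\<close>,
  a positive, unital, trace preserving map. The fourth is the triangle
  inequality together with \<open>|||Z||| = |||Z*|||\<close>, and the fifth, an instance of Ando's Young inequality, follows by
  counting eigenvalues with the tangent lines of \<open>x\<^bsup>2-2t\<^esup>\<close> and \<open>x\<^bsup>-2t\<^esup>\<close> at \<open>1\<close>.\<close>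

section \<open>Matrix arithmetic and quadratic forms\<close>

text \<open>Spectra are carried as unordered families. Sums of \<open>(x - c)^+\<close> and counts
  of eigenvalues above a level do not see the order, and their comparison for all \<open>c\<close>
  is exactly weak majorization; so eigenvalues are never sorted, and a dimension count does the work
  of the min-max principle. Why log-determinants measure the loss: summed over the spectrum, only
  \<open>ln\<close> is additive under products, while its positive and negative parts are merely
  monotone. For \<open>F\<close> and its cut-down version \<open>F'\<close>, write the
  \<open>ln_plus\<close> sum of \<open>F\<close> as the \<open>ln\<close> sum minus the
  \<open>ln_minus\<close> sum, and replace the latter by the smaller one of \<open>F'\<close>. If
  \<open>F'\<close> has no eigenvalue above \<open>1\<close>, what remains is a difference of
  log-determinants, which is computed exactly. The first two inequalities compare logarithms;
  \<open>exp\<close>, being increasing and convex, brings the comparison back to the spectra. The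
  fifth is stronger, since it holds singular value by singular value. Its tangent line at
  \<open>x^(2-2t)\<close> requires concavity, hence \<open>t \<ge> 1/2\<close>; the other half
  follows by exchanging \<open>A\<close> and \<open>B\<close> and passing to the adjoint.\<close>

lemma adj_mult: "adj (A ** B) = adj B ** adj A"
  by (simp add: adj_def matrix_matrix_mult_def vec_eq_iff mult.commute)

lemma adj_adj [simp]: "adj (adj A) = A"
  by (simp add: adj_def vec_eq_iff)

lemma adj_add: "adj (A + B) = adj A + adj B"
  by (simp add: adj_def vec_eq_iff)

lemma adj_diff: "adj (A - B) = adj A - adj B"
  by (simp add: adj_def vec_eq_iff)

lemma adj_scaleR: "adj (c *\<^sub>R A) = c *\<^sub>R adj A"
  by (simp add: adj_def vec_eq_iff)

lemma adj_mat_1 [simp]: "adj (mat 1) = mat 1"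
  by (simp add: adj_def vec_eq_iff mat_def)

lemma adj_real_diag [simp]: "adj (real_diag d) = real_diag d"
  by (simp add: adj_def vec_eq_iff real_diag_def)

lemma mult_real_diag_nth: "(M ** real_diag g) $ i $ j = M $ i $ j * complex_of_real (g j)"
  by (simp add: matrix_matrix_mult_def real_diag_def if_distrib cong: if_cong)

lemma real_diag_mult_nth: "(real_diag g ** M) $ i $ j = complex_of_real (g i) * M $ i $ j"
  by (simp add: matrix_matrix_mult_def real_diag_def if_distrib if_distribR cong: if_cong)

lemma real_diag_nth: "real_diag d $ i $ j = (if i = j then complex_of_real (d i) else 0)"
  by (simp add: real_diag_def)

lemma real_diag_mult: "real_diag d ** real_diag e = real_diag (\<lambda>i. d i * e i)"
  by (simp add: vec_eq_iff real_diag_mult_nth real_diag_nth)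

lemma real_diag_add: "real_diag d + real_diag e = real_diag (\<lambda>i. d i + e i)"
  by (simp add: real_diag_def vec_eq_iff)

lemma real_diag_diff: "real_diag d - real_diag e = real_diag (\<lambda>i. d i - e i)"
  by (simp add: real_diag_def vec_eq_iff)

lemma real_diag_scaleR: "c *\<^sub>R real_diag d = real_diag (\<lambda>i. c * d i)"
  by (simp add: real_diag_def vec_eq_iff) (simp add: scaleR_conv_of_real)

lemma real_diag_1: "real_diag (\<lambda>i. 1) = mat 1"
  by (simp add: real_diag_def vec_eq_iff mat_def)

lemma real_diag_vec: "(real_diag d *v x) $ i = complex_of_real (d i) * x $ i"
  by (simp add: real_diag_def matrix_vector_mult_def if_distrib if_distribR cong: if_cong)

lemma matrix_mult_diff_left: "(A - B) ** C = A ** C - B ** (C :: complex^'n^'n)"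
  by (simp add: matrix_matrix_mult_def vec_eq_iff left_diff_distrib sum_subtractf)

lemma matrix_mult_diff_right: "C ** (A - B) = C ** A - C ** (B :: complex^'n^'n)"
  by (simp add: matrix_matrix_mult_def vec_eq_iff right_diff_distrib sum_subtractf)

lemma matrix_mult_add_left: "(A + B) ** C = A ** C + B ** (C :: complex^'n^'n)"
  by (simp add: matrix_matrix_mult_def vec_eq_iff distrib_right sum.distrib)

lemma matrix_mult_scaleR_left: "(c *\<^sub>R A) ** B = c *\<^sub>R (A ** (B :: complex^'n^'n))"
  by (simp add: matrix_matrix_mult_def vec_eq_iff scaleR_sum_right)

lemma matrix_mult_scaleR_right: "A ** (c *\<^sub>R B) = c *\<^sub>R (A ** (B :: complex^'n^'n))"
  by (simp add: matrix_matrix_mult_def vec_eq_iff scaleR_sum_right)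

lemma matrix_vector_scaleR_left: "(c *\<^sub>R A) *v x = c *\<^sub>R (A *v (x :: complex^'n))"
  by (simp add: matrix_vector_mult_def vec_eq_iff scaleR_sum_right)

lemma matrix_vector_scaleR_right: "A *v (c *\<^sub>R x) = c *\<^sub>R (A *v (x :: complex^'n))"
  by (simp add: matrix_vector_mult_def vec_eq_iff scaleR_sum_right)

lemmas matrix_mult_distribs =
  matrix_mult_diff_left matrix_mult_diff_right matrix_mult_add_left matrix_add_ldistrib
  matrix_mult_scaleR_left matrix_mult_scaleR_right

lemma unitaryD:
  assumes "unitary U"
  shows "adj U ** U = mat 1" "U ** adj U = mat 1" "M ** adj U ** U = M" "M ** U ** adj U = M"
proof -
  show *: "adj U ** U = mat 1" "U ** adj U = mat 1"
    using assms by (simp_all add: unitary_def)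
  show "M ** adj U ** U = M" "M ** U ** adj U = M"
    unfolding matrix_mul_assoc[symmetric] * by (rule matrix_mul_rid)+
qed

lemma unitary_adj: "unitary U \<Longrightarrow> unitary (adj U)"
  by (simp add: unitary_def)

lemma unitary_mat_1: "unitary (mat 1)"
  by (simp add: unitary_def)

lemma unitaryI: "adj U ** U = mat 1 \<Longrightarrow> unitary (U :: complex^'n^'n)"
  using matrix_left_right_inverse[of "adj U" U] by (simp add: unitary_def)

lemma inner_adj: "x \<bullet> (A *v y) = (adj A *v x) \<bullet> (y :: complex^'n)"
proof -
  have "x \<bullet> (A *v y) = (\<Sum>i\<in>UNIV. \<Sum>j\<in>UNIV. x $ i \<bullet> (A $ i $ j * y $ j))"
    by (simp add: inner_vec_def matrix_vector_mult_def inner_sum_right)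
  also have "\<dots> = (\<Sum>i\<in>UNIV. \<Sum>j\<in>UNIV. (cnj (A $ i $ j) * x $ i) \<bullet> y $ j)"
    by (intro sum.cong refl) (simp add: inner_complex_def algebra_simps)
  also have "\<dots> = (\<Sum>j\<in>UNIV. \<Sum>i\<in>UNIV. (cnj (A $ i $ j) * x $ i) \<bullet> y $ j)"
    by (rule sum.swap)
  also have "\<dots> = (adj A *v x) \<bullet> y"
    by (simp add: inner_vec_def matrix_vector_mult_def inner_sum_left adj_def)
  finally show ?thesis .
qed

lemma unitary_inner: "unitary U \<Longrightarrow> (U *v x) \<bullet> (U *v y) = x \<bullet> y"
  by (simp add: inner_adj[of "U *v x"] matrix_vector_mul_assoc unitaryD)

lemma hermitian_inner: "hermitian A \<Longrightarrow> x \<bullet> (A *v y) = (A *v x) \<bullet> (y :: complex^'n)"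
  by (metis inner_adj hermitian_def)

text \<open>The inner product of \<open>complex^'n\<close> as a real space is the real part of the
  Hermitian one. So the form is real-valued for every matrix and sees only its Hermitian
  part.\<close>

definition quad_form :: "complex^'n^'n \<Rightarrow> complex^'n \<Rightarrow> real"
  where "quad_form A x = x \<bullet> (A *v x)"

lemma quad_form_alt: "quad_form A x = Re (\<Sum>i\<in>UNIV. cnj (x $ i) * (A *v x) $ i)"
  by (simp add: quad_form_def inner_vec_def inner_complex_def)

lemma quad_form_add: "quad_form (A + B) x = quad_form A x + quad_form B x"
  by (simp add: quad_form_def matrix_vector_mult_add_rdistrib inner_add_right)

lemma quad_form_diff: "quad_form (A - B) x = quad_form A x - quad_form B x"
  by (simp add: quad_form_def matrix_vector_mult_diff_rdistrib inner_diff_right)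

lemma quad_form_scaleR: "quad_form (c *\<^sub>R A) x = c * quad_form A x"
  by (simp add: quad_form_def matrix_vector_scaleR_left)

lemma quad_form_mat_1: "quad_form (mat 1) x = x \<bullet> x"
  by (simp add: quad_form_def)

lemma quad_form_minus: "quad_form (- A) x = - quad_form A x"
  using quad_form_scaleR[of "-1" A x] by simp

lemma quad_form_shift: "quad_form (a *\<^sub>R A + c *\<^sub>R mat 1) x = a * quad_form A x + c * (x \<bullet> x)"
  by (simp only: quad_form_add quad_form_scaleR quad_form_mat_1)

lemma quad_form_zero [simp]: "quad_form A 0 = 0"
  by (simp add: quad_form_def)

lemma quad_form_cong: "quad_form (adj R ** A ** R) x = quad_form A (R *v x)"
  by (simp add: quad_form_def inner_adj flip: matrix_vector_mul_assoc)

lemma quad_form_cong': "quad_form (R ** A ** adj R) x = quad_form A (adj R *v x)"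
  using quad_form_cong[of "adj R"] by simp

lemma quad_form_real_diag: "quad_form (real_diag d) x = (\<Sum>i\<in>UNIV. d i * (norm (x $ i))\<^sup>2)"
  by (simp add: quad_form_def inner_vec_def real_diag_vec power2_norm_eq_inner inner_complex_def algebra_simps)

lemma inner_self_sum: "x \<bullet> x = (\<Sum>i\<in>UNIV. (norm (x $ i))\<^sup>2)" for x :: "complex^'n"
  by (simp add: inner_vec_def power2_norm_eq_inner)

lemma pos_def_iff: "pos_def A \<longleftrightarrow> hermitian A \<and> (\<forall>x. x \<noteq> 0 \<longrightarrow> quad_form A x > 0)"
  by (simp add: pos_def_def quad_form_alt)

lemma pos_defI: "hermitian A \<Longrightarrow> (\<And>x. x \<noteq> 0 \<Longrightarrow> quad_form A x > 0) \<Longrightarrow> pos_def A"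
  by (simp add: pos_def_iff)

lemma pos_def_hermitian: "pos_def A \<Longrightarrow> hermitian A"
  by (simp add: pos_def_iff)

text \<open>This compares Hermitian parts, hence is a preorder on all matrices; on Hermitian ones it
  is the Loewner order.\<close>

definition loewner_le :: "complex^'n^'n \<Rightarrow> complex^'n^'n \<Rightarrow> bool"  (infix "\<preceq>" 50)
  where "A \<preceq> B \<longleftrightarrow> (\<forall>x. quad_form A x \<le> quad_form B x)"

lemma loewner_le_refl [simp]: "A \<preceq> A"
  by (simp add: loewner_le_def)

lemma loewner_le_trans [trans]: "A \<preceq> B \<Longrightarrow> B \<preceq> C \<Longrightarrow> A \<preceq> C"
  unfolding loewner_le_def by (meson order_trans)

lemma loewner_le_cong: "A \<preceq> B \<Longrightarrow> adj R ** A ** R \<preceq> adj R ** B ** R"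
  by (simp add: loewner_le_def quad_form_cong)

lemma loewner_le_cong': "A \<preceq> B \<Longrightarrow> R ** A ** adj R \<preceq> R ** B ** adj R"
  by (simp add: loewner_le_def quad_form_cong')

lemma loewner_le_cong_hermitian: "A \<preceq> B \<Longrightarrow> hermitian R \<Longrightarrow> R ** A ** R \<preceq> R ** B ** R"
  by (metis loewner_le_cong hermitian_def)

lemma loewner_le_real_diag: "(\<And>i. d i \<le> e i) \<Longrightarrow> real_diag d \<preceq> real_diag e"
  by (auto simp: loewner_le_def quad_form_real_diag intro!: sum_mono mult_right_mono)

lemma hermitian_cong: "hermitian A \<Longrightarrow> hermitian (adj R ** A ** R)"
  by (simp add: hermitian_def adj_mult matrix_mul_assoc)

lemma hermitian_cong': "hermitian A \<Longrightarrow> hermitian (R ** A ** adj R)"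
  by (simp add: hermitian_def adj_mult matrix_mul_assoc)

lemma hermitian_real_diag [simp]: "hermitian (real_diag d)"
  by (simp add: hermitian_def)

lemma hermitian_mat_1 [simp]: "hermitian (mat 1)"
  by (simp add: hermitian_def)

lemma hermitian_add: "hermitian A \<Longrightarrow> hermitian B \<Longrightarrow> hermitian (A + B)"
  by (simp add: hermitian_def adj_add)

lemma hermitian_diff: "hermitian A \<Longrightarrow> hermitian B \<Longrightarrow> hermitian (A - B)"
  by (simp add: hermitian_def adj_diff)

lemma hermitian_scaleR: "hermitian A \<Longrightarrow> hermitian (c *\<^sub>R A)"
  by (simp add: hermitian_def adj_scaleR)

lemma inj_of_left_inverse: "L ** R = mat 1 \<Longrightarrow> x \<noteq> 0 \<Longrightarrow> R *v x \<noteq> (0 :: complex^'n)"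
  using matrix_vector_mul_assoc[of L R x] by auto

lemma pos_def_cong:
  assumes "pos_def A" "L ** R = mat 1"
  shows "pos_def (adj R ** A ** R)"
  using assms inj_of_left_inverse[OF assms(2)]
  by (auto simp: pos_def_iff hermitian_cong quad_form_cong)

lemma pos_def_real_diag:
  assumes d: "\<And>i. d i > 0"
  shows "pos_def (real_diag d :: complex^'n^'n)"
proof (rule pos_defI)
  fix x :: "complex^'n" assume "x \<noteq> 0"
  then obtain k where "x $ k \<noteq> 0" by (auto simp: vec_eq_iff)
  then show "quad_form (real_diag d) x > 0"
    using d less_imp_le[OF d] unfolding quad_form_real_diag
    by (intro sum_pos2[of _ k]) auto
qed simp

lemma pos_def_add: "pos_def A \<Longrightarrow> pos_def B \<Longrightarrow> pos_def (A + B)"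
  by (auto simp: pos_def_iff hermitian_add quad_form_add intro: add_pos_pos)

lemma pos_def_scaleR: "pos_def A \<Longrightarrow> c > 0 \<Longrightarrow> pos_def (c *\<^sub>R A)"
  by (auto simp: pos_def_iff hermitian_scaleR quad_form_scaleR)

text \<open>A homogeneous system with more unknowns, indexed by \<open>I\<close>, than equations,
  indexed by \<open>J\<close>, has a nonzero solution. This replaces intersecting subspaces, both in
  the spectral theorem and in eigenvalue counting.\<close>

lemma kernel_on_support:
  fixes M :: "complex^'n^'n"
  assumes "card J < card I"
  obtains x where "x \<noteq> 0" "\<And>i. i \<notin> I \<Longrightarrow> x $ i = 0" "\<And>j. j \<in> J \<Longrightarrow> (M *v x) $ j = 0"
proof -
  obtain p where p: "inj_on p J" "p ` J \<subseteq> I"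
    using card_le_inj[of J I] assms by auto
  have "card (p ` J) < card I" using p assms by (simp add: card_image)
  then obtain k where k: "k \<in> I" "k \<notin> p ` J"
    using p(2) by (metis less_irrefl subset_antisym subset_iff)
  define F :: "complex^'n^'n" where "F = (\<chi> i. if i \<in> p ` J then (\<chi> m. if m \<in> I then M $ (inv_into J p i) $ m else 0)
      else if i \<in> I then 0 else axis i 1)"
  have "row k F = 0" using k by (simp add: row_def F_def vec_eq_iff)
  then have "det F = 0" by (rule det_zero_row)
  then have "\<not> invertible F" by (simp add: invertible_det_nz)
  then obtain x where x: "F *v x = 0" "x \<noteq> 0"
    using matrix_left_invertible_ker[of F] by (auto simp: invertible_left_inverse)
  have x0: "x $ i = 0" if "i \<notin> I" for i
  proof -
    have "i \<notin> p ` J" using that p(2) by auto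
    then have "F $ i = axis i 1" using that by (simp add: F_def)
    then have F: "F $ i $ j * x $ j = (if j = i then x $ j else 0)" for j
      by (simp add: axis_def)
    have "(F *v x) $ i = x $ i"
      unfolding matrix_vector_mult_def by (simp add: F)
    then show ?thesis using x by simp
  qed
  have "(M *v x) $ j = 0" if "j \<in> J" for j
  proof -
    have "(F *v x) $ (p j) = (\<Sum>m\<in>UNIV. (if m \<in> I then M $ j $ m else 0) * x $ m)"
    proof -
      have "inv_into J p (p j) = j" by (rule inv_into_f_f[OF p(1) that])
      then have "F $ p j = (\<chi> m. if m \<in> I then M $ j $ m else 0)"
        using that by (simp add: F_def cong: if_cong)
      then show ?thesis by (simp add: matrix_vector_mult_def)
    qed
    also have "\<dots> = (\<Sum>m\<in>UNIV. M $ j $ m * x $ m)"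
      using x0 by (intro sum.cong) auto
    finally have "(F *v x) $ p j = (M *v x) $ j" by (simp add: matrix_vector_mult_def)
    then show ?thesis using x by simp
  qed
  with x x0 that show thesis by blast
qed

section \<open>Spectral theorem and functional calculus\<close>

text \<open>The complex inner product. Orthonormal columns of a \<open>unitary\<close> matrix need
  its full value, of which \<open>\<bullet>\<close> is only the real part.\<close>

definition cdot :: "complex^'n \<Rightarrow> complex^'n \<Rightarrow> complex"
  where "cdot x y = (\<Sum>i\<in>UNIV. cnj (x $ i) * y $ i)"

lemma cdot_adj: "cdot x (A *v y) = cdot (adj A *v x) y"
proof -
  have "cdot x (A *v y) = (\<Sum>i\<in>UNIV. \<Sum>j\<in>UNIV. cnj (x $ i) * (A $ i $ j * y $ j))"
    by (simp add: cdot_def matrix_vector_mult_def sum_distrib_left)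
  also have "\<dots> = (\<Sum>j\<in>UNIV. \<Sum>i\<in>UNIV. cnj (x $ i) * (A $ i $ j * y $ j))"
    by (rule sum.swap)
  also have "\<dots> = cdot (adj A *v x) y"
    by (simp add: cdot_def matrix_vector_mult_def sum_distrib_left adj_def algebra_simps)
  finally show ?thesis .
qed

lemma cdot_diff: "cdot x (y - z) = cdot x y - cdot x z"
  by (simp add: cdot_def right_diff_distrib sum_subtractf)

lemma cdot_scaleR: "cdot x (c *\<^sub>R y) = complex_of_real c * cdot x y"
  by (simp add: cdot_def sum_distrib_left scaleR_conv_of_real[where 'a = complex] algebra_simps)

lemma cdot_scaleR_left: "cdot (c *\<^sub>R x) y = complex_of_real c * cdot x y"
  by (simp add: cdot_def sum_distrib_left scaleR_conv_of_real[where 'a = complex] algebra_simps)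

lemma cdot_commute: "cdot x y = cnj (cdot y x)"
  by (simp add: cdot_def mult.commute)

lemma cdot_self: "cdot x x = complex_of_real (x \<bullet> x)"
  by (simp add: cdot_def inner_self_sum mult.commute flip: complex_norm_square)

lemma continuous_on_cdot [continuous_intros]: "continuous_on S (\<lambda>y. cdot x y)"
  unfolding cdot_def by (intro continuous_intros)

lemma continuous_on_quad_form: "continuous_on S (quad_form A)"
  unfolding quad_form_def by (intro continuous_intros linear_continuous_on) auto

text \<open>If \<open>H v\<close> were nonzero, a small step from \<open>v\<close> against
  \<open>H v\<close> would make the form negative. Positivity is asked only at the vectors met on
  the way, because it will be known only on an invariant subspace.\<close>

lemma psd_kernel:
  assumes H: "hermitian H" and pos: "\<And>c. 0 \<le> quad_form H (v - c *\<^sub>R (H *v v))" and "0 \<le> quad_form H (H *v v)" and "quad_form H v = 0"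
  shows "H *v v = 0"
proof (rule ccontr)
  define y q n where "y = H *v v" and "q = quad_form H y" and "n = y \<bullet> y"
  assume "H *v v \<noteq> 0"
  then have n: "n > 0" by (simp add: n_def y_def)
  have q: "q \<ge> 0" using assms(3) by (simp add: q_def y_def)
  have "0 \<le> quad_form H (v - c *\<^sub>R y)" for c using pos by (simp add: y_def)
  moreover have "quad_form H (v - c *\<^sub>R y) = c\<^sup>2 * q - 2 * c * n" for c
  proof -
    have "y \<bullet> (H *v v) = n" "v \<bullet> (H *v y) = n"
      using hermitian_inner[OF H, of v y] by (simp_all add: n_def y_def)
    moreover have "v \<bullet> (H *v v) = 0" using assms(4) by (simp add: quad_form_def)
    ultimately show ?thesis
      by (simp add: quad_form_def q_def inner_diff_left inner_diff_right matrix_vector_scaleR_right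
          matrix_vector_mult_diff_distrib power2_eq_square algebra_simps)
  qed
  \<comment> \<open>The step \<open>c = n / (q + 1)\<close> lies in the range where
    \<open>c^2 q - 2 c n < 0\<close>; the \<open>+ 1\<close> covers \<open>q = 0\<close>.\<close>
  ultimately have "0 \<le> (n / (q + 1))\<^sup>2 * q - 2 * (n / (q + 1)) * n" by metis
  also have "\<dots> = (n / (q + 1)) * (n * (q / (q + 1) - 2))"
    by (simp add: power2_eq_square algebra_simps)
  also have "\<dots> < 0"
    using n q by (intro mult_pos_neg) (auto simp: field_simps)
  finally show False by simp
qed

definition eigensystem :: "complex^'n^'n \<Rightarrow> 'n set \<Rightarrow> ('n \<Rightarrow> complex^'n) \<Rightarrow> ('n \<Rightarrow> real) \<Rightarrow> bool"
  where "eigensystem A I u d \<longleftrightarrow>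
    (\<forall>i\<in>I. \<forall>j\<in>I. cdot (u i) (u j) = (if i = j then 1 else 0)) \<and> (\<forall>i\<in>I. A *v u i = d i *\<^sub>R u i)"

text \<open>Rayleigh's argument on the orthogonal complement \<open>E\<close> of the vectors found
  so far, which \<open>A\<close> maps into itself. At a maximiser \<open>v\<close> of the form on
  the unit sphere of \<open>E\<close>, the matrix \<open>c - A\<close> is nonnegative on
  \<open>E\<close> and its form vanishes at \<open>v\<close>, so \<open>v\<close> is an eigenvector
  by \<open>psd_kernel\<close>.\<close>

lemma eigensystem_extend:
  fixes A :: "complex^'n^'n"
  assumes A: "hermitian A" and sys: "eigensystem A I u d" and k: "k \<notin> I"
  obtains v c where "eigensystem A (insert k I) (u(k := v)) (d(k := c))"
proof -
  define E where "E = {x. \<forall>i\<in>I. cdot (u i) x = 0}"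
  define S where "S = E \<inter> sphere 0 1"
  have E_scale: "c *\<^sub>R x \<in> E" if "x \<in> E" for c x
    using that by (simp add: E_def cdot_scaleR)
  have E_diff: "x - y \<in> E" if "x \<in> E" "y \<in> E" for x y
    using that by (simp add: E_def cdot_diff)
  have E_A: "A *v x \<in> E" if "x \<in> E" for x
    using that sys A by (simp add: E_def eigensystem_def cdot_adj cdot_scaleR_left hermitian_def)
  \<comment> \<open>Fewer orthogonality conditions than dimensions, so \<open>E\<close> contains a
    nonzero vector and \<open>S\<close> is nonempty.\<close>
  have "card I < card (UNIV :: 'n set)"
    using k by (intro psubset_card_mono) auto
  then obtain x where x: "x \<noteq> 0" "\<And>j. j \<in> I \<Longrightarrow> ((\<chi> i m. cnj (u i $ m)) *v x) $ j = 0"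
    using kernel_on_support[where I = UNIV and M = "\<chi> i m. cnj (u i $ m)"] by metis
  have "x \<in> E" using x(2) by (simp add: E_def cdot_def matrix_vector_mult_def)
  then have ne: "(1 / norm x) *\<^sub>R x \<in> S" using x(1) E_scale by (simp add: S_def)
  have "closed E"
  proof -
    have "E = (\<Inter>i\<in>I. {x. cdot (u i) x = 0})" by (auto simp: E_def)
    then show ?thesis
      by (auto intro!: closed_INT closed_Collect_eq continuous_on_cdot continuous_on_const)
  qed
  then have "compact S" unfolding S_def by (intro closed_Int_compact) auto
  then obtain v where v: "v \<in> S" "\<And>y. y \<in> S \<Longrightarrow> quad_form A y \<le> quad_form A v"
    using continuous_attains_sup[of S "quad_form A"] ne continuous_on_quad_form by blast
  define c where "c = quad_form A v"
  define H where "H = c *\<^sub>R mat 1 - A"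
  have H: "hermitian H" using A by (simp add: H_def hermitian_diff hermitian_scaleR)
  have vv: "v \<bullet> v = 1" "v \<in> E" using v(1) by (simp_all add: S_def dot_square_norm)
  have Hy: "quad_form H y = c * (y \<bullet> y) - quad_form A y" for y by (simp add: H_def quad_form_diff quad_form_scaleR quad_form_mat_1)
  have pos: "0 \<le> quad_form H y" if "y \<in> E" for y
  proof (cases "y = 0")
    case False
    have "(1 / norm y) *\<^sub>R y \<in> S" using False that E_scale by (simp add: S_def)
    then have "quad_form A ((1 / norm y) *\<^sub>R y) \<le> c" using v(2) by (simp add: c_def)
    then have "quad_form A y / (norm y)\<^sup>2 \<le> c"
      by (simp add: quad_form_def matrix_vector_scaleR_right power2_eq_square)
    then show ?thesis using False by (simp add: Hy dot_square_norm pos_divide_le_eq)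
  qed simp
  have Hv: "H *v v \<in> E"
    using E_diff[OF E_scale[OF vv(2), of c] E_A[OF vv(2)]]
    by (simp add: H_def matrix_vector_mult_diff_rdistrib matrix_vector_scaleR_left)
  have "H *v v = 0"
    by (rule psd_kernel[OF H]) (use pos Hv vv E_diff E_scale in \<open>auto simp: Hy c_def\<close>)
  then have Av: "A *v v = c *\<^sub>R v"
    by (simp add: H_def matrix_vector_mult_diff_rdistrib matrix_vector_scaleR_left)
  have "cdot v (u i) = 0" "cdot (u i) v = 0" if "i \<in> I" for i
    using vv(2) that cdot_commute[of v "u i"] by (auto simp: E_def)
  then have "eigensystem A (insert k I) (u(k := v)) (d(k := c))"
    using sys k Av vv(1) cdot_self[of v] by (auto simp: eigensystem_def)
  then show thesis by (rule that)
qed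

text \<open>\<open>d\<close> lists the eigenvalues with multiplicity, in any order. The relation
  also forces \<open>A\<close> to be Hermitian.\<close>

definition spec :: "complex^'n^'n \<Rightarrow> ('n \<Rightarrow> real) \<Rightarrow> bool"
  where "spec A d \<longleftrightarrow> (\<exists>U. unitary U \<and> A = U ** real_diag d ** adj U)"

lemma specI: "unitary U \<Longrightarrow> A = U ** real_diag d ** adj U \<Longrightarrow> spec A d"
  by (auto simp: spec_def)

lemma unitary_diagI:
  assumes U: "unitary U" and "A ** U = U ** real_diag d"
  shows "A = U ** real_diag d ** adj U"
  using assms(2) unitaryD(4)[OF U, of A] by simp

theorem spectral:
  fixes A :: "complex^'n^'n"
  assumes A: "hermitian A"
  obtains U d where "unitary U" "A = U ** real_diag d ** adj U"
proof -
  have "\<exists>u d. eigensystem A I u d" if "finite I" for I :: "'n set"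
    using that
  proof (induction I)
    case empty
    then show ?case by (simp add: eigensystem_def)
  next
    case (insert k I)
    then obtain u d where "eigensystem A I u d" by blast
    from eigensystem_extend[OF A this insert.hyps(2)] show ?case by blast
  qed
  from this[OF finite[of UNIV]] obtain u d where sys: "eigensystem A UNIV u d" by (elim exE)
  define U :: "complex^'n^'n" where "U = (\<chi> i j. u j $ i)"
  have "adj U ** U = mat 1"
    using sys by (auto simp: eigensystem_def cdot_def U_def adj_def matrix_matrix_mult_def mat_def vec_eq_iff)
  then have U: "unitary U" by (rule unitaryI)
  have "A ** U = U ** real_diag d"
  proof -
    have "(A ** U) $ i $ j = (U ** real_diag d) $ i $ j" for i j
    proof -
      have "(A ** U) $ i $ j = (A *v u j) $ i"
        by (simp add: U_def matrix_matrix_mult_def matrix_vector_mult_def)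
      also have "\<dots> = d j *\<^sub>R u j $ i" using sys by (simp add: eigensystem_def)
      finally show ?thesis by (simp add: mult_real_diag_nth U_def scaleR_conv_of_real[where 'a = complex])
    qed
    then show ?thesis by (simp add: vec_eq_iff)
  qed
  then show thesis using that[OF U unitary_diagI[OF U]] by blast
qed

lemma hermitian_spec: "hermitian A \<Longrightarrow> \<exists>d. spec A d"
  by (rule spectral[of A]) (auto intro: specI)

lemma pos_def_unitary_diag:
  assumes U: "unitary U" and A: "A = U ** real_diag d ** adj U"
  shows "pos_def A \<longleftrightarrow> (\<forall>i. d i > 0)"
proof
  assume p: "pos_def A"
  show "\<forall>i. d i > 0"
  proof
    fix i
    have "real_diag d = adj U ** A ** U" using U by (simp add: A matrix_mul_assoc unitaryD)
    then have "pos_def (real_diag d)" using pos_def_cong[OF p unitaryD(1)[OF U]] by simp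
    then have "quad_form (real_diag d) (axis i 1) > 0" by (simp add: pos_def_iff axis_eq_0_iff)
    moreover have "quad_form (real_diag d) (axis i 1) = (\<Sum>j\<in>UNIV. if j = i then d j else 0)"
      unfolding quad_form_real_diag by (intro sum.cong) (auto simp: axis_def)
    ultimately show "d i > 0" by simp
  qed
next
  assume "\<forall>i. d i > 0"
  then have "pos_def (real_diag d)" by (simp add: pos_def_real_diag)
  then show "pos_def A" using pos_def_cong[of "real_diag d" U "adj U"] U by (simp add: A unitaryD)
qed

lemma spec_pos_def: "spec A d \<Longrightarrow> pos_def A \<longleftrightarrow> (\<forall>i. d i > 0)"
  unfolding spec_def using pos_def_unitary_diag by blast

lemma pos_def_spectral:
  assumes "pos_def A"
  obtains U d where "unitary U" "A = U ** real_diag d ** adj U" "\<And>i. d i > 0"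
proof -
  obtain U d where U: "unitary U" "A = U ** real_diag d ** adj U"
    by (rule spectral[OF pos_def_hermitian[OF assms]])
  then show thesis using that pos_def_unitary_diag[OF U] assms by blast
qed

lemma unitary_conj_mult:
  assumes "unitary U"
  shows "(U ** X ** adj U) ** (U ** Y ** adj U) = U ** (X ** Y) ** adj U"
  by (simp add: matrix_mul_assoc unitaryD[OF assms])

lemma unitary_conj_diag_mult:
  assumes "unitary U"
  shows "(U ** real_diag d ** adj U) ** (U ** real_diag e ** adj U) = U ** real_diag (\<lambda>i. d i * e i) ** adj U"
  by (simp add: unitary_conj_mult[OF assms] real_diag_mult)

lemma unitary_conj_1: "unitary U \<Longrightarrow> U ** real_diag (\<lambda>i. 1) ** adj U = mat 1"
  by (simp add: real_diag_1 unitaryD)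

lemma quad_form_unitary_diag: "quad_form (U ** real_diag d ** adj U) x = (\<Sum>i\<in>UNIV. d i * (norm ((adj U *v x) $ i))\<^sup>2)"
  by (simp add: quad_form_cong' quad_form_real_diag)

lemma inner_unitary_sum:
  assumes "unitary U"
  shows "x \<bullet> x = (\<Sum>i\<in>UNIV. (norm ((adj U *v x) $ i))\<^sup>2)"
  using unitary_inner[OF unitary_adj[OF assms], of x x] by (simp add: inner_self_sum)

lemma mat_powr_eq:
  assumes "unitary U" and "A = U ** real_diag d ** adj U"
  shows "mat_powr A s = U ** real_diag (\<lambda>i. d i powr s) ** adj U"
  unfolding mat_powr_def by (rule mat_fun_eq[OF assms])

lemma mat_ln_eq:
  assumes "unitary U" and "A = U ** real_diag d ** adj U"
  shows "mat_ln A = U ** real_diag (\<lambda>i. ln (d i)) ** adj U"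
  unfolding mat_ln_def by (rule mat_fun_eq[OF assms])

lemma mat_fun_hermitian: "hermitian A \<Longrightarrow> hermitian (mat_fun f A)"
  by (rule spectral[of A]) (simp_all add: mat_fun_eq hermitian_cong')

lemma mat_fun_comp:
  assumes "hermitian A"
  shows "mat_fun f (mat_fun g A) = mat_fun (\<lambda>x. f (g x)) A"
proof -
  obtain U d where U: "unitary U" "A = U ** real_diag d ** adj U" by (rule spectral[OF assms])
  show ?thesis using mat_fun_eq[OF U(1) mat_fun_eq[OF U, of g], of f] mat_fun_eq[OF U] by simp
qed

lemma mat_fun_mult:
  assumes "hermitian A"
  shows "mat_fun f A ** mat_fun g A = mat_fun (\<lambda>x. f x * g x) A"
proof -
  obtain U d where U: "unitary U" "A = U ** real_diag d ** adj U" by (rule spectral[OF assms])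
  show ?thesis by (simp add: mat_fun_eq[OF U] unitary_conj_diag_mult[OF U(1)])
qed

lemma mat_fun_cong_pos:
  assumes "pos_def A" "\<And>x. x > 0 \<Longrightarrow> f x = g x"
  shows "mat_fun f A = mat_fun g A"
proof -
  obtain U d where U: "unitary U" "A = U ** real_diag d ** adj U" "\<And>i. d i > 0"
    using pos_def_spectral[OF assms(1)] by blast
  show ?thesis by (simp add: mat_fun_eq[OF U(1,2)] assms(2) U(3))
qed

lemma mat_fun_id: "hermitian A \<Longrightarrow> mat_fun (\<lambda>x. x) A = A"
  by (rule spectral[of A]) (simp_all add: mat_fun_eq)

lemma mat_fun_pos_def:
  assumes "pos_def A" "\<And>x. x > 0 \<Longrightarrow> f x > 0"
  shows "pos_def (mat_fun f A)"
proof -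
  obtain U d where U: "unitary U" "A = U ** real_diag d ** adj U" "\<And>i. d i > 0"
    using pos_def_spectral[OF assms(1)] by blast
  show ?thesis using pos_def_unitary_diag[OF U(1) mat_fun_eq[OF U(1,2), of f]] assms(2) U(3) by simp
qed

lemma mat_powr_pos_def: "pos_def A \<Longrightarrow> pos_def (mat_powr A s)"
  unfolding mat_powr_def by (rule mat_fun_pos_def) auto

lemma mat_powr_hermitian: "pos_def A \<Longrightarrow> hermitian (mat_powr A s)"
  by (simp add: mat_powr_pos_def pos_def_hermitian)

lemma mat_powr_mult: "pos_def A \<Longrightarrow> mat_powr A s ** mat_powr A r = mat_powr A (s + r)"
  unfolding mat_powr_def
  by (simp add: mat_fun_mult pos_def_hermitian powr_add)

lemma mat_powr_mult_assoc: "pos_def A \<Longrightarrow> M ** mat_powr A s ** mat_powr A r = M ** mat_powr A (s + r)"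
  by (simp add: mat_powr_mult flip: matrix_mul_assoc)

lemma mat_powr_1: "pos_def A \<Longrightarrow> mat_powr A 1 = A"
  unfolding mat_powr_def using mat_fun_cong_pos[of A "\<lambda>x. x powr 1" "\<lambda>x. x"]
  by (simp add: mat_fun_id pos_def_hermitian)

lemma mat_powr_0:
  assumes "pos_def A"
  shows "mat_powr A 0 = mat 1"
proof -
  obtain U d where U: "unitary U" "A = U ** real_diag d ** adj U" "\<And>i. d i > 0"
    using pos_def_spectral[OF assms(1)] by blast
  have "d i \<noteq> 0" for i using U(3)[of i] by simp
  then show ?thesis by (simp add: mat_powr_eq[OF U(1,2)] real_diag_1 unitaryD U(1))
qed

lemma mat_powr_powr: "pos_def A \<Longrightarrow> mat_powr (mat_powr A s) r = mat_powr A (s * r)"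
  unfolding mat_powr_def by (simp add: mat_fun_comp pos_def_hermitian powr_powr)

lemma scaleR_unitary_diag:
  assumes "A = U ** real_diag d ** adj U"
  shows "c *\<^sub>R A = U ** real_diag (\<lambda>i. c * d i) ** adj U"
  by (simp add: assms matrix_mult_distribs flip: real_diag_scaleR)

lemma mat_ln_powr:
  assumes "pos_def A"
  shows "mat_ln (mat_powr A s) = s *\<^sub>R mat_ln A"
proof -
  obtain U d where U: "unitary U" "A = U ** real_diag d ** adj U" "\<And>i. d i > 0"
    using pos_def_spectral[OF assms(1)] by blast
  have "d i \<noteq> 0" for i using U(3)[of i] by simp
  then show ?thesis
    using mat_ln_eq[OF U(1) mat_powr_eq[OF U(1,2), of s]]
    by (simp add: scaleR_unitary_diag[OF mat_ln_eq[OF U(1,2)]] ln_powr)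
qed

lemma mat_ln_hermitian: "pos_def A \<Longrightarrow> hermitian (mat_ln A)"
  unfolding mat_ln_def by (simp add: mat_fun_hermitian pos_def_hermitian)

lemma mat_powr_scaleR:
  assumes "pos_def A" "c > 0"
  shows "mat_powr (c *\<^sub>R A) s = (c powr s) *\<^sub>R mat_powr A s"
proof -
  obtain U d where U: "unitary U" "A = U ** real_diag d ** adj U" "\<And>i. d i > 0"
    using pos_def_spectral[OF assms(1)] by blast
  show ?thesis
    using mat_powr_eq[OF U(1) scaleR_unitary_diag[OF U(2), of c], of s] assms(2) U(3)
    by (simp add: scaleR_unitary_diag[OF mat_powr_eq[OF U(1,2)]] powr_mult less_imp_le)
qed

lemma mat_ln_scaleR:
  assumes "pos_def A" "c > 0"
  shows "mat_ln (c *\<^sub>R A) = ln c *\<^sub>R mat 1 + mat_ln A"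
proof -
  obtain U d where U: "unitary U" "A = U ** real_diag d ** adj U" "\<And>i. d i > 0"
    using pos_def_spectral[OF assms(1)] by blast
  have "d i \<noteq> 0" "c \<noteq> 0" for i using U(3)[of i] assms(2) by simp_all
  then have "mat_ln (c *\<^sub>R A) = U ** (real_diag (\<lambda>i. ln c * 1) + real_diag (\<lambda>i. ln (d i))) ** adj U"
    using mat_ln_eq[OF U(1) scaleR_unitary_diag[OF U(2), of c]] assms(2) U(3)
    by (simp add: real_diag_add ln_mult)
  then show ?thesis
    unfolding real_diag_scaleR[symmetric] matrix_mult_distribs
    by (simp add: mat_ln_eq[OF U(1,2)] real_diag_1 unitaryD U(1))
qed

lemma mat_powr_inverse:
  assumes "pos_def A"
  shows "mat_powr A s ** mat_powr A (-s) = mat 1" "mat_powr A (-s) ** mat_powr A s = mat 1"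
  by (simp_all add: mat_powr_mult mat_powr_0 assms)

lemma pos_def_cong_hermitian:
  assumes "pos_def A" "pos_def R"
  shows "pos_def (R ** A ** R)"
  using pos_def_cong[OF assms(1), of "mat_powr R (-1)" R] mat_powr_inverse(2)[OF assms(2), of 1] assms(2)
  by (simp add: mat_powr_1 pos_def_hermitian[unfolded hermitian_def])

lemma power_unitary_diag:
  "(((**) (U ** real_diag d ** adj U)) ^^ k) (mat 1) = U ** real_diag (\<lambda>i. d i ^ k) ** adj U" if "unitary U"
proof (induction k)
  case 0
  then show ?case using that by (simp add: real_diag_1 unitaryD)
next
  case (Suc k)
  then show ?case by (simp add: unitary_conj_diag_mult[OF that])
qed

text \<open>The diagonal matrices conjugated by \<open>U\<close> are the image of the real vectors
  under a linear map \<open>f\<close>. In finite dimension \<open>f\<close> is bounded and carries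
  convergent series along, which leaves the scalar exponential series in each coordinate.\<close>

lemma mat_exp_eq:
  assumes "unitary U" and "A = U ** real_diag d ** adj U"
  shows "mat_exp A = U ** real_diag (\<lambda>i. exp (d i)) ** adj U"
proof -
  define f where "f v = U ** real_diag (($) v) ** adj U" for v
  have diag: "real_diag (($) (v + w)) = real_diag (($) v) + real_diag (($) w)"
    "real_diag (($) (c *\<^sub>R v)) = c *\<^sub>R real_diag (($) v)" for v w :: "real^'a" and c
    by (simp_all add: vec_eq_iff real_diag_nth scaleR_conv_of_real[where 'a = complex])
  have "linear f"
    by (rule linearI) (simp_all add: f_def diag matrix_mult_distribs)
  then have "bounded_linear f" by (rule linear_conv_bounded_linear[THEN iffD1])
  moreover have "(\<lambda>k. (1 / fact k) *\<^sub>R (\<chi> i. d i ^ k)) sums (\<chi> i. exp (d i))"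
    unfolding sums_def
  proof (rule vec_tendstoI)
    fix i
    show "(\<lambda>n. (\<Sum>k<n. (1 / fact k) *\<^sub>R (\<chi> i. d i ^ k)) $ i) \<longlonglongrightarrow> (\<chi> i. exp (d i)) $ i"
      using exp_converges[of "d i"] by (simp add: sums_def sum_component field_simps)
  qed
  ultimately have "(\<lambda>k. f ((1 / fact k) *\<^sub>R (\<chi> i. d i ^ k))) sums f (\<chi> i. exp (d i))"
    by (rule bounded_linear.sums)
  then have "(\<lambda>k. (1 / fact k) *\<^sub>R (U ** real_diag (\<lambda>i. d i ^ k) ** adj U)) sums (U ** real_diag (\<lambda>i. exp (d i)) ** adj U)"
    by (simp add: f_def diag matrix_mult_distribs vec_lambda_inverse)
  then show ?thesis
    unfolding mat_exp_def assms(2) power_unitary_diag[OF assms(1)] by (rule sums_unique[symmetric])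
qed

section \<open>Eigenvalue counting\<close>

text \<open>For Hermitian \<open>A\<close> this is the sum of \<open>f\<close> over the eigenvalues,
  expressed without choosing an enumeration of them.\<close>

definition trace_fun :: "(real \<Rightarrow> real) \<Rightarrow> complex^'n^'n \<Rightarrow> real"
  where "trace_fun f A = Re (trace (mat_fun f A))"

lemma trace_unitary_diag:
  assumes "unitary U"
  shows "trace (U ** real_diag d ** adj U) = complex_of_real (\<Sum>i\<in>UNIV. d i)"
proof -
  have "trace (U ** real_diag d ** adj U) = trace (adj U ** (U ** real_diag d))"
    by (rule trace_mul_sym)
  also have "\<dots> = trace (real_diag d)" by (simp add: matrix_mul_assoc unitaryD[OF assms])
  finally show ?thesis by (simp add: trace_def real_diag_nth)
qed

lemma trace_fun_spec:
  assumes "spec A d"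
  shows "trace_fun f A = (\<Sum>i\<in>UNIV. f (d i))"
proof -
  obtain U where U: "unitary U" "A = U ** real_diag d ** adj U" using assms by (auto simp: spec_def)
  show ?thesis by (simp add: trace_fun_def mat_fun_eq[OF U] trace_unitary_diag[OF U(1)])
qed

lemma spec_mat_fun: "spec A d \<Longrightarrow> spec (mat_fun f A) (\<lambda>i. f (d i))"
  unfolding spec_def using mat_fun_eq by blast

lemma spec_powr: "spec A d \<Longrightarrow> spec (mat_powr A s) (\<lambda>i. d i powr s)"
  unfolding mat_powr_def by (rule spec_mat_fun)

lemma spec_scaleR: "spec A d \<Longrightarrow> spec (c *\<^sub>R A) (\<lambda>i. c * d i)"
  unfolding spec_def using scaleR_unitary_diag by blast

lemma spec_shift:
  assumes "spec A d"
  shows "spec (a *\<^sub>R A + c *\<^sub>R mat 1) (\<lambda>i. a * d i + c)"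
proof -
  obtain U where U: "unitary U" "A = U ** real_diag d ** adj U" using assms by (auto simp: spec_def)
  have "a *\<^sub>R A + c *\<^sub>R mat 1 = U ** (real_diag (\<lambda>i. a * d i) + real_diag (\<lambda>i. c * 1)) ** adj U"
    unfolding matrix_mult_distribs real_diag_scaleR[symmetric] unitary_conj_1[OF U(1)] U(2) ..
  then show ?thesis using U(1) by (auto simp: spec_def real_diag_add)
qed

text \<open>An inertia argument. If \<open>H\<close> had more nonnegative eigenvalues than
  \<open>K\<close>, some nonzero vector built from the nonnegative eigenvectors of \<open>H\<close>
  would be sent by \<open>R\<close> into the span of the negative eigenvectors of \<open>K\<close>,
  where the form of \<open>K\<close> is negative.\<close>

lemma card_spectrum_le:
  fixes R :: "complex^'n^'n"
  assumes d: "spec H d" and e: "spec K e"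
    and RK: "\<And>x. x \<noteq> 0 \<Longrightarrow> 0 \<le> quad_form H x \<Longrightarrow> R *v x \<noteq> 0 \<and> 0 \<le> quad_form K (R *v x)"
  shows "card {i. 0 \<le> d i} \<le> card {i. 0 \<le> e i}"
proof (rule ccontr)
  assume "\<not> ?thesis"
  then have c: "card {i. 0 \<le> e i} < card {i. 0 \<le> d i}" by simp
  obtain U where U: "unitary U" "H = U ** real_diag d ** adj U" using d by (auto simp: spec_def)
  obtain V where V: "unitary V" "K = V ** real_diag e ** adj V" using e by (auto simp: spec_def)
  \<comment> \<open>\<open>x\<close> holds coordinates in the eigenbasis of \<open>H\<close>; the
    equations kill the coordinates of its image along the nonnegative eigenvectors of
    \<open>K\<close>.\<close>
  obtain x where x: "x \<noteq> 0" "\<And>i. i \<notin> {i. 0 \<le> d i} \<Longrightarrow> x $ i = 0"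
    "\<And>j. j \<in> {i. 0 \<le> e i} \<Longrightarrow> ((adj V ** R ** U) *v x) $ j = 0"
    using kernel_on_support[OF c] by blast
  have "quad_form H (U *v x) = quad_form (real_diag d) x"
    using quad_form_cong[of U H x] U by (simp add: matrix_mul_assoc unitaryD)
  also have "\<dots> \<ge> 0" unfolding quad_form_real_diag
  proof (rule sum_nonneg)
    fix i show "0 \<le> d i * (norm (x $ i))\<^sup>2" using x(2)[of i] by (cases "0 \<le> d i") auto
  qed
  finally have "R *v (U *v x) \<noteq> 0" and K: "0 \<le> quad_form K (R *v (U *v x))"
    using RK inj_of_left_inverse[OF unitaryD(1)[OF U(1)] x(1)] by blast+
  define y where "y = (adj V ** R ** U) *v x"
  have y_eq: "y = adj V *v (R *v (U *v x))"
    by (simp add: y_def matrix_vector_mul_assoc matrix_mul_assoc)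
  have "y \<noteq> 0"
    using inj_of_left_inverse[OF unitaryD(2)[OF V(1)]] \<open>R *v (U *v x) \<noteq> 0\<close> by (simp add: y_eq)
  then obtain k where k: "y $ k \<noteq> 0" by (auto simp: vec_eq_iff)
  then have ek: "e k < 0" using x(3)[of k] by (force simp: y_def)
  have "quad_form K (R *v (U *v x)) = (\<Sum>j\<in>UNIV. e j * (norm (y $ j))\<^sup>2)"
    by (simp add: V(2) quad_form_unitary_diag y_eq)
  also have "\<dots> < 0"
  proof -
    have "0 < (\<Sum>j\<in>UNIV. - (e j * (norm (y $ j))\<^sup>2))"
    proof (rule sum_pos2[of _ k])
      show "0 < - (e k * (norm (y $ k))\<^sup>2)" using ek k by (simp add: mult_neg_pos)
    next
      fix j
      show "0 \<le> - (e j * (norm (y $ j))\<^sup>2)"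
        using x(3)[of j] by (cases "0 \<le> e j") (auto simp: y_def mult_nonpos_nonneg)
    qed auto
    then show ?thesis by (simp add: sum_negf)
  qed
  finally show False using K by simp
qed

text \<open>Greedy matching of the largest values of the two families.\<close>

lemma sum_le_of_card_le:
  fixes d e :: "'a \<Rightarrow> real" and g :: "real \<Rightarrow> real"
  assumes "finite I" "finite J"
    and "\<And>i j. i \<in> I \<Longrightarrow> j \<in> J \<Longrightarrow> d i \<le> e j \<Longrightarrow> g (d i) \<le> g (e j)"
    and "\<And>s. card {i \<in> I. s \<le> d i} \<le> card {j \<in> J. s \<le> e j}" and "card I = card J"
  shows "(\<Sum>i\<in>I. g (d i)) \<le> (\<Sum>j\<in>J. g (e j))"
  using assms
proof (induction "card I" arbitrary: I J)
  case 0
  then show ?case by simp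
next
  case (Suc n)
  have ne: "I \<noteq> {}" "J \<noteq> {}" using Suc.hyps(2) Suc.prems(5) by auto
  obtain i where i: "i \<in> I" "\<And>k. k \<in> I \<Longrightarrow> d k \<le> d i"
  proof -
    have "Max (d ` I) \<in> d ` I" using Suc.prems(1) ne by (intro Max_in) auto
    then obtain m where m: "Max (d ` I) = d m" "m \<in> I" by (elim imageE)
    have "d k \<le> d m" if "k \<in> I" for k using Suc.prems(1) that by (simp flip: m(1))
    then show thesis using that m(2) by blast
  qed
  obtain j where j: "j \<in> J" "\<And>k. k \<in> J \<Longrightarrow> e k \<le> e j"
  proof -
    have "Max (e ` J) \<in> e ` J" using Suc.prems(2) ne by (intro Max_in) auto
    then obtain m where m: "Max (e ` J) = e m" "m \<in> J" by (elim imageE)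
    have "e k \<le> e m" if "k \<in> J" for k using Suc.prems(2) that by (simp flip: m(1))
    then show thesis using that m(2) by blast
  qed
  \<comment> \<open>Counting at the level \<open>d i\<close> shows that some value of
    \<open>e\<close>, hence the largest one, reaches the largest value of \<open>d\<close>.\<close>
  have "card {k \<in> I. d i \<le> d k} > 0" using i Suc.prems(1) by (auto simp: card_gt_0_iff)
  then have "{k \<in> J. d i \<le> e k} \<noteq> {}" using Suc.prems(4)[of "d i"] by (metis card.empty not_le)
  then have ij: "d i \<le> e j" using j(2) by force
  have "(\<Sum>k\<in>I - {i}. g (d k)) \<le> (\<Sum>k\<in>J - {j}. g (e k))"
  proof (rule Suc.hyps(1))
    show "n = card (I - {i})" using Suc.hyps(2) i(1) Suc.prems(1) by simp
    show "card (I - {i}) = card (J - {j})" using Suc.prems i(1) j(1) by simp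
    fix s
    show "card {k \<in> I - {i}. s \<le> d k} \<le> card {k \<in> J - {j}. s \<le> e k}"
    proof (cases "s \<le> d i")
      case True
      have "{k \<in> I - {i}. s \<le> d k} = {k \<in> I. s \<le> d k} - {i}" "{k \<in> J - {j}. s \<le> e k} = {k \<in> J. s \<le> e k} - {j}"
        by auto
      then show ?thesis using Suc.prems(4)[of s] Suc.prems(1,2) True ij i(1) j(1) by simp
    next
      case False
      then have "{k \<in> I - {i}. s \<le> d k} = {}" using i(2) by force
      then show ?thesis by (simp only: card.empty le0)
    qed
  qed (use Suc.prems in auto)
  moreover have "g (d i) \<le> g (e j)" using Suc.prems(3)[OF i(1) j(1) ij] .
  ultimately show ?case
    using Suc.prems(1,2) i(1) j(1) by (simp add: sum.remove[of I i] sum.remove[of J j])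
qed

lemma sum_spectrum_mono:
  fixes X Y :: "complex^'n^'n" and g :: "real \<Rightarrow> real"
  assumes d: "spec X d" and e: "spec Y e" and le: "X \<preceq> Y"
    and g: "\<And>i j. d i \<le> e j \<Longrightarrow> g (d i) \<le> g (e j)"
  shows "(\<Sum>i\<in>UNIV. g (d i)) \<le> (\<Sum>i\<in>UNIV. g (e i))"
proof (rule sum_le_of_card_le[where g = g and d = d and e = e])
  fix i j
  assume "d i \<le> e j"
  then show "g (d i) \<le> g (e j)" by (rule g)
next
  fix s
  have "card {i. 0 \<le> 1 * d i + - s} \<le> card {i. 0 \<le> 1 * e i + - s}"
    by (rule card_spectrum_le[OF spec_shift[OF d] spec_shift[OF e], of _ _ "mat 1"])
      (use le in \<open>auto simp: quad_form_add quad_form_diff quad_form_scaleR quad_form_mat_1 loewner_le_def intro: order_trans\<close>)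
  then show "card {i \<in> UNIV. s \<le> d i} \<le> card {i \<in> UNIV. s \<le> e i}" by simp
qed auto

lemma trace_fun_mono:
  assumes X: "pos_def X" and Y: "pos_def Y" and le: "X \<preceq> Y"
    and g: "\<And>x y. 0 < x \<Longrightarrow> x \<le> y \<Longrightarrow> g x \<le> g y"
  shows "trace_fun g X \<le> trace_fun g Y"
proof -
  obtain d e where de: "spec X d" "spec Y e" using hermitian_spec pos_def_hermitian X Y by blast
  then have "d i > 0" for i using spec_pos_def X by blast
  then show ?thesis using sum_spectrum_mono[OF de le] g by (simp add: trace_fun_spec[OF de(1)] trace_fun_spec[OF de(2)])
qed

text \<open>The singular value decomposition of an invertible \<open>T\<close>: its adjoint maps the
  eigenvectors of \<open>T ** adj T\<close> to those of \<open>adj T ** T\<close>, and dividing by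
  the singular values \<open>sqrt (d i)\<close> makes them the columns of a unitary
  \<open>V\<close>.\<close>

lemma spec_mult_adj_commute:
  assumes inv: "L ** T = mat 1" and d: "spec (T ** adj T) d"
  shows "spec (adj T ** T) d"
proof -
  obtain U where U: "unitary U" "T ** adj T = U ** real_diag d ** adj U" using d by (auto simp: spec_def)
  have "adj T ** adj L = mat 1" using arg_cong[OF inv, of adj] by (simp add: adj_mult)
  then have "adj L ** adj T = mat 1" by (simp add: matrix_left_right_inverse)
  then have "pos_def (T ** adj T)"
    using pos_def_cong[of "mat 1" "adj L" "adj T"] pos_def_real_diag[of "\<lambda>_. 1"]
    by (simp add: real_diag_1)
  then have dp: "d i > 0" for i using d spec_pos_def by blast
  have nz: "d i \<noteq> 0" "d i powr (-1/2) * d i powr (-1/2) * d i = 1" "d i * d i powr (-1/2) = d i powr (-1/2) * d i" for i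
    using dp[of i] powr_neg_one[of "d i"] by (simp_all flip: powr_add)
  define V where "V = adj T ** U ** real_diag (\<lambda>i. d i powr (-1/2))"
  have TU: "T ** adj T ** U = U ** real_diag d" using U by (simp add: unitaryD)
  have "adj V ** V = real_diag (\<lambda>i. d i powr (-1/2)) ** adj U ** (T ** adj T ** U) ** real_diag (\<lambda>i. d i powr (-1/2))"
    by (simp add: V_def adj_mult matrix_mul_assoc)
  also have "\<dots> = real_diag (\<lambda>i. d i powr (-1/2)) ** real_diag d ** real_diag (\<lambda>i. d i powr (-1/2))"
    unfolding TU by (simp add: matrix_mul_assoc unitaryD[OF U(1)])
  also have "\<dots> = mat 1" using nz by (simp add: real_diag_mult algebra_simps real_diag_1)
  finally have V: "unitary V" by (rule unitaryI)
  have "adj T ** T ** V = adj T ** (T ** adj T ** U) ** real_diag (\<lambda>i. d i powr (-1/2))"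
    by (simp add: V_def matrix_mul_assoc)
  also have "\<dots> = adj T ** U ** (real_diag d ** real_diag (\<lambda>i. d i powr (-1/2)))"
    unfolding TU by (simp add: matrix_mul_assoc)
  also have "\<dots> = V ** real_diag d"
    unfolding V_def real_diag_mult nz(3) matrix_mul_assoc[symmetric] ..
  finally have "adj T ** T = V ** real_diag d ** adj V" by (rule unitary_diagI[OF V])
  with V show ?thesis by (rule specI)
qed

section \<open>Operator monotone functions\<close>

lemma loewner_le_scaled_1:
  assumes "spec A d" "\<And>i. d i \<le> c"
  shows "A \<preceq> c *\<^sub>R mat 1"
proof -
  obtain U where U: "unitary U" "A = U ** real_diag d ** adj U" using assms by (auto simp: spec_def)
  have "A \<preceq> U ** real_diag (\<lambda>i. c * 1) ** adj U" unfolding U(2) by (intro loewner_le_cong' loewner_le_real_diag) (simp add: assms(2))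
  also have "U ** real_diag (\<lambda>i. c * 1) ** adj U = c *\<^sub>R mat 1"
    unfolding real_diag_scaleR[symmetric] matrix_mult_distribs unitary_conj_1[OF U(1)] ..
  finally show ?thesis .
qed

lemma mat_powr_sandwich_cancel:
  assumes "pos_def S"
  shows "mat_powr S (-a) ** (mat_powr S a ** X ** mat_powr S a) ** mat_powr S (-a) = X"
    and "mat_powr S a ** (mat_powr S (-a) ** X ** mat_powr S (-a)) ** mat_powr S a = X"
  by (simp_all add: matrix_mul_assoc mat_powr_inverse[OF assms] mat_powr_mult_assoc[OF assms] mat_powr_0[OF assms])

lemma loewner_le_sandwich:
  assumes "pos_def S" "mat_powr S a ** X ** mat_powr S a \<preceq> mat_powr S a ** Y ** mat_powr S a"
  shows "X \<preceq> Y"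
  using loewner_le_cong_hermitian[OF assms(2) mat_powr_hermitian[OF assms(1), of "-a"]]
  by (simp add: mat_powr_sandwich_cancel[OF assms(1)])

lemma inner_powr:
  assumes "pos_def A"
  shows "(mat_powr A a *v x) \<bullet> (mat_powr A b *v y) = x \<bullet> (mat_powr A (a + b) *v y)"
  using hermitian_inner[OF mat_powr_hermitian[OF assms], of x a "mat_powr A b *v y"]
  by (simp add: matrix_vector_mul_assoc mat_powr_mult[OF assms])

text \<open>An eigenvector \<open>v\<close> of the sandwich yields \<open>w\<close> with \<open>A\<^sup>m w = e B\<^sup>m w\<close>; pairing this
  with \<open>y = B\<^bsup>(s-u)/2\<^esup> w\<close> makes Cauchy-Schwarz an equality on the side of \<open>B\<close>.\<close>

lemma mat_powr_mono_midpoint: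
  fixes A B :: "complex^'n^'n"
  assumes A: "pos_def A" and B: "pos_def B"
    and s: "mat_powr A s \<preceq> mat_powr B s" and u: "mat_powr A u \<preceq> mat_powr B u"
  shows "mat_powr A ((s + u) / 2) \<preceq> mat_powr B ((s + u) / 2)"
proof -
  define m where "m = (s + u) / 2"
  define M where "M = mat_powr B (-m/2) ** mat_powr A m ** mat_powr B (-m/2)"
  have "pos_def M"
    unfolding M_def by (intro pos_def_cong_hermitian mat_powr_pos_def A B)
  then obtain V e where V: "unitary V" "M = V ** real_diag e ** adj V"
    using spectral[OF pos_def_hermitian] by blast
  have "e i \<le> 1" for i
  proof -
    define v where "v = V *v axis i 1"
    define w where "w = mat_powr B (-m/2) *v v"
    define y where "y = mat_powr B ((s - u) / 2) *v w"
    define q where "q = quad_form (mat_powr B s) w"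
    have "v \<noteq> 0" unfolding v_def
      by (rule inj_of_left_inverse[OF unitaryD(1)[OF V(1)]]) (simp add: axis_eq_0_iff)
    have vw: "v = mat_powr B (m/2) *v w"
      using mat_powr_inverse(1)[OF B, of "m/2"] by (simp add: w_def matrix_vector_mul_assoc)
    have "w \<noteq> 0" using \<open>v \<noteq> 0\<close> vw by auto
    then have q: "q > 0" using mat_powr_pos_def[OF B] by (simp add: q_def pos_def_iff)
    have "real_diag e *v axis i 1 = e i *\<^sub>R (axis i 1 :: complex^'n)"
      by (simp add: vec_eq_iff real_diag_vec axis_def scaleR_conv_of_real[where 'a = complex])
    then have Mv: "M *v v = e i *\<^sub>R v"
      using unitaryD(3)[OF V(1), of "V ** real_diag e"]
      by (simp add: v_def V(2) matrix_vector_mul_assoc flip: matrix_vector_scaleR_right)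
        (simp flip: matrix_vector_mul_assoc)
    have "mat_powr A m *v w = (mat_powr B (m/2) ** M) *v v"
      using mat_powr_inverse(1)[OF B, of "m/2"]
      by (simp add: M_def w_def matrix_vector_mul_assoc matrix_mul_assoc)
    also have "\<dots> = e i *\<^sub>R (mat_powr B (m/2) *v v)"
      by (simp add: Mv matrix_vector_scaleR_right flip: matrix_vector_mul_assoc)
    also have "mat_powr B (m/2) *v v = mat_powr B m *v w"
      by (simp add: vw matrix_vector_mul_assoc mat_powr_mult[OF B])
    finally have Aw: "mat_powr A m *v w = e i *\<^sub>R (mat_powr B m *v w)" .
    have "y \<bullet> (mat_powr B m *v w) = q"
      using inner_powr[OF B, of "(s-u)/2" w m w] by (simp add: y_def q_def quad_form_def m_def field_simps)
    then have "e i * q = y \<bullet> (mat_powr A m *v w)" by (simp add: Aw)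
    also have "\<dots> = (mat_powr A (u/2) *v y) \<bullet> (mat_powr A (s/2) *v w)"
      by (simp add: inner_powr[OF A] m_def field_simps)
    also have "\<dots> \<le> norm (mat_powr A (u/2) *v y) * norm (mat_powr A (s/2) *v w)"
      by (rule norm_cauchy_schwarz)
    also have "\<dots> \<le> sqrt q * sqrt q"
    proof (intro mult_mono)
      have "(norm (mat_powr A (s/2) *v w))\<^sup>2 = quad_form (mat_powr A s) w"
        by (simp add: power2_norm_eq_inner inner_powr[OF A] quad_form_def)
      also have "\<dots> \<le> q" using s by (simp add: loewner_le_def q_def)
      finally show "norm (mat_powr A (s/2) *v w) \<le> sqrt q" by (rule real_le_rsqrt)
      have "(norm (mat_powr A (u/2) *v y))\<^sup>2 = quad_form (mat_powr A u) y"
        by (simp add: power2_norm_eq_inner inner_powr[OF A] quad_form_def)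
      also have "\<dots> \<le> quad_form (mat_powr B u) y" using u by (simp add: loewner_le_def)
      also have "\<dots> = q"
        by (simp add: quad_form_def q_def y_def matrix_vector_mul_assoc mat_powr_mult[OF B] inner_powr[OF B] field_simps)
      finally show "norm (mat_powr A (u/2) *v y) \<le> sqrt q" by (rule real_le_rsqrt)
    qed (use q in auto)
    also have "\<dots> = q" using q by simp
    finally show "e i \<le> 1" using q by simp
  qed
  then have "M \<preceq> mat 1" using loewner_le_scaled_1[OF specI[OF V], of 1] by simp
  then have "mat_powr B (-m/2) ** mat_powr A m ** mat_powr B (-m/2)
      \<preceq> mat_powr B (-m/2) ** mat_powr B m ** mat_powr B (-m/2)"
    by (simp add: M_def mat_powr_mult[OF B] mat_powr_0[OF B])
  from loewner_le_sandwich[OF B this] show ?thesis by (simp add: m_def)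
qed

lemma quad_form_powr:
  assumes "unitary U" and "A = U ** real_diag d ** adj U"
  shows "quad_form (mat_powr A s) x = (\<Sum>i\<in>UNIV. d i powr s * (norm ((adj U *v x) $ i))\<^sup>2)"
  by (simp add: mat_powr_eq[OF assms] quad_form_unitary_diag)

lemma continuous_quad_form_powr:
  assumes "pos_def A"
  shows "continuous_on S (\<lambda>s. quad_form (mat_powr A s) x)"
proof -
  obtain U d where U: "unitary U" "A = U ** real_diag d ** adj U" "\<And>i. d i > 0"
    using pos_def_spectral[OF assms(1)] by blast
  have "d i \<noteq> 0" for i using U(3)[of i] by simp
  then show ?thesis unfolding quad_form_powr[OF U(1,2)] by (intro continuous_intros) auto
qed

text \<open>The set \<open>E\<close> of good exponents is closed, contains \<open>0\<close> and
  \<open>1\<close>, and is closed under midpoints. An exponent outside \<open>E\<close> would lie in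
  a gap of \<open>E\<close> with endpoints \<open>a\<close>, \<open>b\<close> in \<open>E\<close>,
  and the midpoint of the gap gives a contradiction.\<close>

theorem loewner_heinz:
  assumes A: "pos_def A" and B: "pos_def B" and AB: "A \<preceq> B" and s: "0 \<le> s" "s \<le> 1"
  shows "mat_powr A s \<preceq> mat_powr B s"
proof (rule ccontr)
  assume neg: "\<not> ?thesis"
  define E where "E = {r. mat_powr A r \<preceq> mat_powr B r}"
  have "E = (\<Inter>x. {r. quad_form (mat_powr A r) x \<le> quad_form (mat_powr B r) x})"
    by (auto simp: E_def loewner_le_def)
  then have E: "closed E"
    by (auto intro!: closed_INT closed_Collect_le continuous_quad_form_powr A B)
  have "0 \<in> E" "1 \<in> E" using AB by (simp_all add: E_def mat_powr_0 mat_powr_1 A B)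
  have "compact (E \<inter> {0..s})" "compact (E \<inter> {s..1})" using E by (auto intro: closed_Int_compact)
  moreover have "0 \<in> E \<inter> {0..s}" "1 \<in> E \<inter> {s..1}" using s \<open>0 \<in> E\<close> \<open>1 \<in> E\<close> by auto
  ultimately obtain a b where a: "a \<in> E \<inter> {0..s}" "\<And>r. r \<in> E \<inter> {0..s} \<Longrightarrow> r \<le> a"
    and b: "b \<in> E \<inter> {s..1}" "\<And>r. r \<in> E \<inter> {s..1} \<Longrightarrow> b \<le> r"
    using compact_attains_sup[of "E \<inter> {0..s}"] compact_attains_inf[of "E \<inter> {s..1}"] by blast
  have "s \<notin> E" using neg by (simp add: E_def)
  then have "a < s" "s < b" using a(1) b(1) by (auto simp: less_le)
  have "(a + b) / 2 \<in> E" using mat_powr_mono_midpoint[OF A B] a(1) b(1) by (simp add: E_def)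
  then show False using a b \<open>a < s\<close> \<open>s < b\<close>
    by (cases "(a + b) / 2 \<le> s") (force simp: field_simps)+
qed

section \<open>The logarithm as derivative of the powers at exponent \<open>0\<close>\<close>

lemma powr_quotient_tendsto:
  assumes "a > (0::real)"
  shows "((\<lambda>r. (a powr r - 1) / r) \<longlongrightarrow> ln a) (at_right 0)"
proof -
  have "((\<lambda>r. a powr r) has_real_derivative ln a) (at 0)"
    using assms by (auto intro!: derivative_eq_intros)
  then have "((\<lambda>r. (a powr r - 1) / r) \<longlongrightarrow> ln a) (at 0)"
    using assms by (simp add: DERIV_def)
  then show ?thesis by (rule filterlim_mono) (simp_all add: at_le)
qed

lemma quad_form_powr_quotient_tendsto:
  assumes "pos_def A"
  shows "((\<lambda>r. (quad_form (mat_powr A r) x - x \<bullet> x) / r) \<longlongrightarrow> quad_form (mat_ln A) x) (at_right 0)"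
proof -
  obtain U d where U: "unitary U" "A = U ** real_diag d ** adj U" "\<And>i. d i > 0"
    using pos_def_spectral[OF assms(1)] by blast
  have "((\<lambda>r. \<Sum>i\<in>UNIV. (d i powr r - 1) / r * (norm ((adj U *v x) $ i))\<^sup>2) \<longlongrightarrow> quad_form (mat_ln A) x) (at_right 0)"
    unfolding mat_ln_eq[OF U(1,2)] quad_form_unitary_diag
    by (intro tendsto_intros powr_quotient_tendsto U)
  moreover have "(\<Sum>i\<in>UNIV. (d i powr r - 1) / r * (norm ((adj U *v x) $ i))\<^sup>2) = (quad_form (mat_powr A r) x - x \<bullet> x) / r" for r
    by (simp add: quad_form_powr[OF U(1,2)] inner_unitary_sum[OF U(1), of x] diff_divide_distrib
        left_diff_distrib sum_subtractf sum_divide_distrib)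
  ultimately show ?thesis by simp
qed

text \<open>The logarithm is the limit of \<open>(A^r - 1) / r\<close> as \<open>r\<close> decreases
  to \<open>0\<close>, and each of these quotients is monotone by Loewner-Heinz.\<close>

theorem mat_ln_mono:
  assumes A: "pos_def A" and B: "pos_def B" and "A \<preceq> B"
  shows "mat_ln A \<preceq> mat_ln B"
  unfolding loewner_le_def
proof
  fix x
  have "\<forall>\<^sub>F r in at_right 0. r \<in> {0<..<1::real}"
    by (rule eventually_at_right_real) simp
  then have "\<forall>\<^sub>F r in at_right 0. (quad_form (mat_powr A r) x - x \<bullet> x) / r \<le> (quad_form (mat_powr B r) x - x \<bullet> x) / r"
    by eventually_elim (use loewner_heinz[OF assms] in \<open>auto simp: loewner_le_def intro!: divide_right_mono\<close>)
  then show "quad_form (mat_ln A) x \<le> quad_form (mat_ln B) x"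
    by (rule tendsto_le[OF _ quad_form_powr_quotient_tendsto[OF B] quad_form_powr_quotient_tendsto[OF A], rotated]) simp
qed

text \<open>The first-order expansion of \<open>A^r\<close> as a one-sided operator bound. Only
  finitely many eigenvalues occur, so one \<open>r\<close> serves them all.\<close>

lemma mat_powr_le_linear:
  assumes "pos_def A" "\<epsilon> > 0"
  shows "\<forall>\<^sub>F r in at_right 0. mat_powr A r \<preceq> mat 1 + r *\<^sub>R (mat_ln A + \<epsilon> *\<^sub>R mat 1)"
proof -
  obtain U d where U: "unitary U" "A = U ** real_diag d ** adj U" "\<And>i. d i > 0"
    using pos_def_spectral[OF assms(1)] by blast
  have "\<forall>\<^sub>F r in at_right 0. (d i powr r - 1) / r < ln (d i) + \<epsilon>" for i
    using powr_quotient_tendsto[OF U(3)[of i]] by (rule order_tendstoD(2)) (simp add: assms)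
  then have "\<forall>\<^sub>F r in at_right 0. \<forall>i. (d i powr r - 1) / r < ln (d i) + \<epsilon>"
    by (rule eventually_all_finite)
  moreover have "\<forall>\<^sub>F r in at_right 0. r \<in> {0<..<1::real}"
    by (rule eventually_at_right_real) simp
  ultimately show ?thesis
  proof eventually_elim
    case (elim r)
    have "d i powr r \<le> 1 + r * (ln (d i) + \<epsilon> * 1)" for i
      using elim(1)[rule_format, of i] elim(2) by (simp add: field_simps)
    then have "mat_powr A r \<preceq> U ** real_diag (\<lambda>i. 1 + r * (ln (d i) + \<epsilon> * 1)) ** adj U"
      unfolding mat_powr_eq[OF U(1,2)] by (intro loewner_le_cong' loewner_le_real_diag)
    also have "\<dots> = mat 1 + r *\<^sub>R (mat_ln A + \<epsilon> *\<^sub>R mat 1)"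
      unfolding real_diag_add[symmetric] real_diag_scaleR[symmetric] matrix_mult_distribs
        unitary_conj_1[OF U(1)] mat_ln_eq[OF U(1,2)] ..
    finally show ?case .
  qed
qed

section \<open>Log-determinants\<close>

lemma det_unitary_diag:
  fixes U :: "complex^'n^'n"
  assumes "unitary U"
  shows "det (U ** real_diag d ** adj U) = complex_of_real (\<Prod>i\<in>UNIV. d i)"
proof -
  have "det U * det (adj U) = det (U ** adj U)" by (simp add: det_mul)
  then have "det U * det (adj U) = 1" using assms by (simp add: unitaryD)
  moreover have "det (real_diag d :: complex^'n^'n) = (\<Prod>i\<in>UNIV. complex_of_real (d i))"
    by (subst det_diagonal) (auto simp: real_diag_nth)
  ultimately show ?thesis by (simp add: det_mul mult.commute mult.left_commute)
qed

lemma trace_fun_ln_det: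
  assumes "pos_def A"
  shows "trace_fun ln A = ln (norm (det A))" "norm (det A) > 0"
proof -
  obtain U d where U: "unitary U" "A = U ** real_diag d ** adj U" "\<And>i. d i > 0"
    using pos_def_spectral[OF assms(1)] by blast
  have *: "norm (det A) = (\<Prod>i\<in>UNIV. d i)"
    unfolding U(2) det_unitary_diag[OF U(1)] norm_of_real using U(3) by (simp add: prod_nonneg less_imp_le)
  then show "norm (det A) > 0" using U(3) by (simp add: prod_pos)
  have "trace_fun ln A = (\<Sum>i\<in>UNIV. ln (d i))" using specI[OF U(1,2)] by (rule trace_fun_spec)
  also have "\<dots> = ln (\<Prod>i\<in>UNIV. d i)" using U(3) by (subst ln_prod) (auto simp: less_le)
  finally show "trace_fun ln A = ln (norm (det A))" by (simp add: *)
qed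

lemma trace_fun_ln_sandwich:
  assumes "pos_def A" "pos_def R"
  shows "trace_fun ln (R ** A ** R) = trace_fun ln A + 2 * trace_fun ln R"
  using assms trace_fun_ln_det[OF assms(1)] trace_fun_ln_det[OF assms(2)]
  by (simp add: trace_fun_ln_det(1)[OF pos_def_cong_hermitian] det_mul norm_mult ln_mult)

section \<open>Geometric mean\<close>

lemma pos_def_mult_adj:
  fixes M L :: "complex^'n^'n"
  assumes "L ** M = mat 1" and "\<And>i. d i > 0"
  shows "pos_def (M ** real_diag d ** adj M)" "pos_def (M ** adj M)"
proof -
  have "adj M ** adj L = mat 1" using arg_cong[OF assms(1), of adj] by (simp add: adj_mult)
  then have L: "adj L ** adj M = mat 1" by (simp add: matrix_left_right_inverse)
  show "pos_def (M ** real_diag d ** adj M)"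
    using pos_def_cong[OF pos_def_real_diag[of d] L] assms(2) by simp
  show "pos_def (M ** adj M)"
    using pos_def_cong[OF pos_def_real_diag[of "\<lambda>_. 1"] L] by (simp add: real_diag_1)
qed

text \<open>Any joint diagonalization by congruence computes the mean: \<open>A^(-1/2) M\<close> is
  unitary and diagonalizes \<open>A^(-1/2) B A^(-1/2)\<close>. With
  \<open>simultaneous_congruence\<close>, questions about the mean turn into scalar ones about
  \<open>d\<close>.\<close>

lemma geo_mean_eq:
  fixes M L :: "complex^'n^'n"
  assumes M: "L ** M = mat 1" and A: "A = M ** adj M" and B: "B = M ** real_diag d ** adj M"
    and d: "\<And>i. d i > 0"
  shows "geo_mean A t B = M ** real_diag (\<lambda>i. d i powr t) ** adj M"
proof -
  have pA: "pos_def A" unfolding A by (rule pos_def_mult_adj(2)[OF M d])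
  define U where "U = mat_powr A (-1/2) ** M"
  have aU: "adj U = adj M ** mat_powr A (-1/2)"
    using mat_powr_hermitian[OF pA, of "-1/2"] by (simp add: U_def adj_mult hermitian_def)
  have "U ** adj U = mat_powr A (-1/2) ** A ** mat_powr A (-1/2)"
    by (simp add: aU) (simp add: U_def A matrix_mul_assoc)
  also have "\<dots> = mat_powr A (-1/2) ** mat_powr A 1 ** mat_powr A (-1/2)" by (simp add: mat_powr_1[OF pA])
  also have "\<dots> = mat 1" by (simp add: mat_powr_mult[OF pA] mat_powr_0[OF pA])
  finally have U: "unitary U" using unitaryI[of "adj U"] unitary_adj by fastforce
  have MU: "mat_powr A (1/2) ** U = M" "adj U ** mat_powr A (1/2) = adj M"
    by (simp_all add: aU) (simp_all add: U_def matrix_mul_assoc mat_powr_mult_assoc[OF pA] mat_powr_mult[OF pA] mat_powr_0[OF pA])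
  have "mat_powr A (-1/2) ** B ** mat_powr A (-1/2) = U ** real_diag d ** adj U"
    by (simp add: aU) (simp add: U_def B matrix_mul_assoc)
  then have "geo_mean A t B = (mat_powr A (1/2) ** U) ** real_diag (\<lambda>i. d i powr t) ** (adj U ** mat_powr A (1/2))"
    unfolding geo_mean_def by (simp add: mat_powr_eq[OF U] matrix_mul_assoc)
  then show ?thesis by (simp add: MU)
qed

lemma simultaneous_congruence:
  fixes A B :: "complex^'n^'n"
  assumes A: "pos_def A" and B: "pos_def B"
  obtains M L d where "L ** M = mat 1" "A = M ** adj M" "B = M ** real_diag d ** adj M" "\<And>i::'n. d i > 0"
proof -
  define C where "C = mat_powr A (-1/2) ** B ** mat_powr A (-1/2)"
  have "pos_def C" unfolding C_def by (intro pos_def_cong_hermitian B mat_powr_pos_def A)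
  then obtain U d where U: "unitary U" "C = U ** real_diag d ** adj U" "\<And>i. d i > 0"
    using pos_def_spectral by blast
  define M where "M = mat_powr A (1/2) ** U"
  define L where "L = adj U ** mat_powr A (-1/2)"
  have aM: "adj M = adj U ** mat_powr A (1/2)"
    using mat_powr_hermitian[OF A, of "1/2"] by (simp add: M_def adj_mult hermitian_def)
  have "L ** M = mat 1"
    by (simp add: L_def M_def matrix_mul_assoc mat_powr_mult_assoc[OF A] mat_powr_0[OF A] unitaryD[OF U(1)])
  moreover have "A = M ** adj M"
    by (simp add: aM) (simp add: M_def matrix_mul_assoc unitaryD[OF U(1)] mat_powr_mult[OF A] mat_powr_1[OF A])
  moreover have "B = M ** real_diag d ** adj M"
  proof -
    have "B = mat_powr A (1/2) ** C ** mat_powr A (1/2)"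
      using mat_powr_sandwich_cancel(2)[OF A, of "1/2" B] by (simp add: C_def)
    then show ?thesis by (simp add: aM) (simp add: M_def U(2) matrix_mul_assoc)
  qed
  ultimately show thesis using U(3) by (rule that)
qed

lemma pos_def_geo_mean:
  assumes A: "pos_def A" and B: "pos_def B"
  shows "pos_def (geo_mean A t B)"
proof -
  obtain M L d where M: "L ** M = mat 1" "A = M ** adj M" "B = M ** real_diag d ** adj M" "\<And>i. d i > 0"
    using simultaneous_congruence[OF assms] by blast
  show ?thesis unfolding geo_mean_eq[OF M] using M(4) by (intro pos_def_mult_adj(1)[OF M(1)]) (simp add: less_le)
qed

text \<open>With \<open>D\<close> the diagonal of the \<open>d i\<close>, replace \<open>M\<close>
  by \<open>M D^(1/2)\<close>: then \<open>B\<close> takes the place of the identity and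
  \<open>A\<close> has diagonal \<open>D^(-1)\<close>. The claim becomes
  \<open>d * (1/d)^(1-t) = d^t\<close>.\<close>

lemma geo_mean_commute:
  assumes A: "pos_def A" and B: "pos_def B"
  shows "geo_mean A t B = geo_mean B (1 - t) A"
proof -
  obtain M L d where M: "L ** M = mat 1" "A = M ** adj M" "B = M ** real_diag d ** adj M" "\<And>i. d i > 0"
    using simultaneous_congruence[OF assms] by blast
  define E where "E = (\<lambda>s. real_diag (\<lambda>i. d i powr s) :: complex^'a^'a)"
  have E: "E r ** E s = E (r + s)" "N ** E r ** E s = N ** E (r + s)" for r s N
    by (simp_all add: E_def real_diag_mult powr_add flip: matrix_mul_assoc)
  have "d i \<noteq> 0" for i using M(4)[of i] by simp
  then have E0: "E 0 = mat 1" by (simp add: E_def real_diag_1)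
  have E1: "E 1 = real_diag d" using M(4) by (simp add: E_def less_imp_le)
  have aE: "adj (M ** E (1/2)) = E (1/2) ** adj M" by (simp add: E_def adj_mult)
  have Em: "real_diag (\<lambda>i. (d i powr -1) powr s) = E (-s)" for s
    by (simp only: E_def powr_powr) simp
  have "geo_mean B (1 - t) A = (M ** E (1/2)) ** real_diag (\<lambda>i. (d i powr -1) powr (1 - t)) ** adj (M ** E (1/2))"
  proof (rule geo_mean_eq)
    show "E (-1/2) ** L ** (M ** E (1/2)) = mat 1"
    proof -
      have "E (-1/2) ** L ** (M ** E (1/2)) = E (-1/2) ** (L ** M) ** E (1/2)" by (simp add: matrix_mul_assoc)
      then show ?thesis by (simp add: M(1) E E0)
    qed
    show "B = (M ** E (1/2)) ** adj (M ** E (1/2))"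
      by (simp add: aE M(3) matrix_mul_assoc E E1)
    have "real_diag (\<lambda>i. d i powr -1) = E (-1)" by (simp add: E_def)
    then show "A = (M ** E (1/2)) ** real_diag (\<lambda>i. d i powr -1) ** adj (M ** E (1/2))"
      by (simp add: aE M(2) matrix_mul_assoc E E0)
    show "0 < d i powr -1" for i using M(4)[of i] by simp
  qed
  also have "\<dots> = M ** E t ** adj M" unfolding Em aE by (simp add: matrix_mul_assoc E)
  also have "\<dots> = geo_mean A t B" by (simp add: geo_mean_eq[OF M] E_def)
  finally show ?thesis by simp
qed

lemma geo_mean_congruence:
  fixes K :: "complex^'n^'n"
  assumes A: "pos_def A" and B: "pos_def B" and K: "L' ** K = mat 1"
  shows "geo_mean (K ** A ** adj K) t (K ** B ** adj K) = K ** geo_mean A t B ** adj K"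
proof -
  obtain M L d where M: "L ** M = mat 1" "A = M ** adj M" "B = M ** real_diag d ** adj M" "\<And>i. d i > 0"
    using simultaneous_congruence[OF A B] by blast
  have "geo_mean (K ** A ** adj K) t (K ** B ** adj K) = (K ** M) ** real_diag (\<lambda>i. d i powr t) ** adj (K ** M)"
  proof (rule geo_mean_eq)
    have "L ** L' ** (K ** M) = L ** (L' ** K) ** M" by (simp add: matrix_mul_assoc)
    then show "L ** L' ** (K ** M) = mat 1" by (simp add: K M(1))
  qed (simp_all add: M adj_mult matrix_mul_assoc)
  then show ?thesis by (simp add: geo_mean_eq[OF M] adj_mult matrix_mul_assoc)
qed

lemma geo_mean_congruence_pos_def:
  assumes "pos_def A" "pos_def B" "pos_def K"
  shows "geo_mean (K ** A ** K) t (K ** B ** K) = K ** geo_mean A t B ** K"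
  using geo_mean_congruence[OF assms(1,2), of "mat_powr K (-1)" K t] mat_powr_inverse(2)[OF assms(3), of 1]
    pos_def_hermitian[OF assms(3)]
  by (simp add: mat_powr_1 assms(3) hermitian_def)

lemma geo_mean_scaleR:
  assumes "pos_def A" "pos_def B" "c > 0"
  shows "geo_mean (c *\<^sub>R A) t (c *\<^sub>R B) = c *\<^sub>R geo_mean A t B"
proof -
  have "pos_def (sqrt c *\<^sub>R mat 1 :: complex^'a^'a)"
    using assms(3) by (intro pos_def_scaleR) (simp_all add: pos_def_real_diag flip: real_diag_1)
  from geo_mean_congruence_pos_def[OF assms(1,2) this, of t] assms(3) show ?thesis
    by (simp add: matrix_mult_distribs)
qed

text \<open>The commuting case. Its use is \<open>a = -t\<close>, \<open>b = 2 - t\<close>, where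
  the exponent of the mean is again \<open>t\<close>.\<close>

lemma geo_mean_powr:
  assumes C: "pos_def C"
  shows "geo_mean (mat_powr C a) t (mat_powr C b) = mat_powr C ((1 - t) * a + t * b)"
proof -
  obtain U d where U: "unitary U" "C = U ** real_diag d ** adj U" "\<And>i. d i > 0"
    using pos_def_spectral[OF C] by blast
  define M where "M = mat_powr C (a/2) ** U"
  have aM: "adj M = adj U ** mat_powr C (a/2)"
    using mat_powr_hermitian[OF C, of "a/2"] by (simp add: M_def adj_mult hermitian_def)
  have conj: "M ** real_diag (\<lambda>i. d i powr s) ** adj M = mat_powr C (a + s)" for s
  proof -
    have "M ** real_diag (\<lambda>i. d i powr s) ** adj M = mat_powr C (a/2) ** mat_powr C s ** mat_powr C (a/2)"
      by (simp add: aM) (simp add: M_def mat_powr_eq[OF U(1,2), of s] matrix_mul_assoc)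
    then show ?thesis by (simp add: mat_powr_mult[OF C] algebra_simps)
  qed
  have "geo_mean (mat_powr C a) t (mat_powr C b) = M ** real_diag (\<lambda>i. (d i powr (b - a)) powr t) ** adj M"
  proof (rule geo_mean_eq)
    show "(adj U ** mat_powr C (-a/2)) ** M = mat 1"
      by (simp add: M_def matrix_mul_assoc mat_powr_mult_assoc[OF C] mat_powr_0[OF C] unitaryD[OF U(1)])
    show "mat_powr C a = M ** adj M"
      by (simp add: aM) (simp add: M_def matrix_mul_assoc unitaryD[OF U(1)] mat_powr_mult[OF C])
    show "mat_powr C b = M ** real_diag (\<lambda>i. d i powr (b - a)) ** adj M" by (simp add: conj)
    show "0 < d i powr (b - a)" for i using U(3)[of i] by simp
  qed
  then show ?thesis by (simp add: powr_powr conj algebra_simps)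
qed

text \<open>After the common congruence this is the scalar inequality
  \<open>d^t \<le> (1 - t) + t d\<close>.\<close>

lemma geo_mean_le_arithmetic:
  assumes A: "pos_def A" and B: "pos_def B" and t: "0 \<le> t" "t \<le> 1"
  shows "geo_mean A t B \<preceq> (1 - t) *\<^sub>R A + t *\<^sub>R B"
proof -
  obtain M L d where M: "L ** M = mat 1" "A = M ** adj M" "B = M ** real_diag d ** adj M" "\<And>i. d i > 0"
    using simultaneous_congruence[OF A B] by blast
  have "d i powr t \<le> (1 - t) * 1 + t * d i" for i
    using Youngs_inequality_0[of "1 - t" t 1 "d i"] t M(4)[of i] by simp
  then have "geo_mean A t B \<preceq> M ** real_diag (\<lambda>i. (1 - t) * 1 + t * d i) ** adj M"
    unfolding geo_mean_eq[OF M] by (intro loewner_le_cong' loewner_le_real_diag)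
  also have "\<dots> = (1 - t) *\<^sub>R A + t *\<^sub>R B"
    unfolding real_diag_add[symmetric] real_diag_scaleR[symmetric] matrix_mult_distribs
    by (simp add: M(2,3) real_diag_1)
  finally show ?thesis .
qed

lemma geo_mean_mono_right:
  assumes A: "pos_def A" and B: "pos_def B" "pos_def B'" "B \<preceq> B'" and t: "0 \<le> t" "t \<le> 1"
  shows "geo_mean A t B \<preceq> geo_mean A t B'"
  unfolding geo_mean_def
  by (intro loewner_le_cong_hermitian mat_powr_hermitian loewner_heinz pos_def_cong_hermitian mat_powr_pos_def A B t)

text \<open>Loewner-Heinz gives monotonicity in the second argument; the symmetry of the mean
  transfers it to the first.\<close>

lemma geo_mean_mono:
  assumes A: "pos_def A" "pos_def A'" "A \<preceq> A'" and B: "pos_def B" "pos_def B'" "B \<preceq> B'"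
    and t: "0 \<le> t" "t \<le> 1"
  shows "geo_mean A t B \<preceq> geo_mean A' t B'"
proof -
  have "geo_mean A t B = geo_mean B (1 - t) A" by (rule geo_mean_commute[OF A(1) B(1)])
  also have "\<dots> \<preceq> geo_mean B (1 - t) A'" using A B t by (intro geo_mean_mono_right) auto
  also have "\<dots> = geo_mean A' t B" by (rule geo_mean_commute[OF A(2) B(1), symmetric])
  also have "\<dots> \<preceq> geo_mean A' t B'" using A B t by (intro geo_mean_mono_right) auto
  finally show ?thesis .
qed

lemma trace_fun_ln_powr:
  assumes "pos_def A"
  shows "trace_fun ln (mat_powr A s) = s * trace_fun ln A"
proof -
  obtain d where d: "spec A d" using hermitian_spec pos_def_hermitian assms by blast
  then have "d i > 0" for i using spec_pos_def assms by blast
  then have "d i \<noteq> 0" for i by (metis less_irrefl)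
  then show ?thesis by (simp add: trace_fun_spec[OF d] trace_fun_spec[OF spec_powr[OF d]] ln_powr sum_distrib_left)
qed

lemma trace_fun_ln_geo_mean:
  assumes A: "pos_def A" and B: "pos_def B"
  shows "trace_fun ln (geo_mean A t B) = (1 - t) * trace_fun ln A + t * trace_fun ln B"
proof -
  define C where "C = mat_powr A (-1/2) ** B ** mat_powr A (-1/2)"
  have C: "pos_def C" unfolding C_def by (intro pos_def_cong_hermitian mat_powr_pos_def A B)
  have lnC: "trace_fun ln C = trace_fun ln B - trace_fun ln A"
    unfolding C_def by (subst trace_fun_ln_sandwich) (simp_all only: B trace_fun_ln_powr A mat_powr_pos_def)
  have "trace_fun ln (geo_mean A t B) = t * trace_fun ln C + trace_fun ln A"
    unfolding geo_mean_def C_def[symmetric]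
    by (subst trace_fun_ln_sandwich) (simp_all add: C trace_fun_ln_powr A mat_powr_pos_def)
  then show ?thesis by (simp add: lnC algebra_simps)
qed

abbreviation ln_plus :: "real \<Rightarrow> real" where "ln_plus x \<equiv> max 0 (ln x)"
text \<open>The nonpositive part, so that the two parts add up to \<open>ln\<close> and both are
  increasing on the positive axis.\<close>

abbreviation ln_minus :: "real \<Rightarrow> real" where "ln_minus x \<equiv> min 0 (ln x)"

lemma trace_fun_ln_split:
  assumes "hermitian A"
  shows "trace_fun ln A = trace_fun ln_plus A + trace_fun ln_minus A"
proof -
  obtain d where d: "spec A d" using hermitian_spec assms by blast
  show ?thesis unfolding trace_fun_spec[OF d] sum.distrib[symmetric] by (rule sum.cong) auto
qed

lemma trace_fun_ln_parts_mono:
  assumes "pos_def X" "pos_def Y" "X \<preceq> Y"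
  shows "trace_fun ln_plus X \<le> trace_fun ln_plus Y" "trace_fun ln_minus X \<le> trace_fun ln_minus Y"
  by (rule trace_fun_mono[OF assms], rule max.mono min.mono, simp_all)+

text \<open>The two sandwiches are \<open>T ** adj T\<close> and \<open>adj T ** T\<close>. Swapping
  brings either factor to the middle, the only position in which the sandwich is monotone for the
  Loewner order.\<close>

lemma trace_fun_sandwich_commute:
  assumes X: "pos_def X" and Y: "pos_def Y"
  shows "trace_fun f (mat_powr X (1/2) ** Y ** mat_powr X (1/2)) = trace_fun f (mat_powr Y (1/2) ** X ** mat_powr Y (1/2))"
proof -
  define T where "T = mat_powr X (1/2) ** mat_powr Y (1/2)"
  have aT: "adj T = mat_powr Y (1/2) ** mat_powr X (1/2)"
    using mat_powr_hermitian[OF X] mat_powr_hermitian[OF Y] by (simp add: T_def adj_mult hermitian_def)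
  have inv: "(mat_powr Y (-1/2) ** mat_powr X (-1/2)) ** T = mat 1"
    by (simp add: T_def matrix_mul_assoc mat_powr_mult_assoc[OF X] mat_powr_0[OF X] mat_powr_mult[OF Y] mat_powr_0[OF Y])
  have TT: "T ** adj T = mat_powr X (1/2) ** Y ** mat_powr X (1/2)"
    "adj T ** T = mat_powr Y (1/2) ** X ** mat_powr Y (1/2)"
    by (simp_all add: aT)
      (simp_all add: T_def matrix_mul_assoc mat_powr_mult_assoc[OF X] mat_powr_mult_assoc[OF Y] mat_powr_1 X Y)
  have "hermitian (T ** adj T)" by (simp add: hermitian_def adj_mult)
  then obtain d where d: "spec (T ** adj T) d" using hermitian_spec by blast
  show ?thesis
    using trace_fun_spec[OF d, of f] trace_fun_spec[OF spec_mult_adj_commute[OF inv d], of f] by (simp add: TT)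
qed

section \<open>Log-majorization of the geometric mean\<close>

text \<open>\<open>K'\<close> is \<open>min 1 K\<close> in the functional calculus. What it loses in
  log-determinant is precisely the sum of the positive logarithms.\<close>

lemma min_1_spectral:
  assumes K: "pos_def K"
  obtains K' where "pos_def K'" "K' \<preceq> K" "K' \<preceq> mat 1" "trace_fun ln_plus K' = 0"
    "trace_fun ln K - trace_fun ln K' = trace_fun ln_plus K"
proof -
  obtain U k where U: "unitary U" "K = U ** real_diag k ** adj U" "\<And>i. k i > 0"
    using pos_def_spectral[OF K] by blast
  define K' where "K' = U ** real_diag (\<lambda>i. min 1 (k i)) ** adj U"
  have s: "spec K k" "spec K' (\<lambda>i. min 1 (k i))" using U K'_def by (auto intro: specI)
  show thesis
  proof (rule that)
    show "pos_def K'" using spec_pos_def[OF s(2)] U(3) by simp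
    show "K' \<preceq> K" unfolding K'_def U(2) by (intro loewner_le_cong' loewner_le_real_diag) simp
    show "K' \<preceq> mat 1" using loewner_le_scaled_1[OF s(2), of 1] by simp
    have min_ln: "ln (k i) - ln (min 1 (k i)) = ln_plus (k i)" "ln_plus (min 1 (k i)) = 0" for i
      using U(3)[of i] by (auto simp: min_def)
    show "trace_fun ln_plus K' = 0" unfolding trace_fun_spec[OF s(2)] min_ln by simp
    show "trace_fun ln K - trace_fun ln K' = trace_fun ln_plus K"
      unfolding trace_fun_spec[OF s(1)] trace_fun_spec[OF s(2)] sum_subtractf[symmetric] min_ln ..
  qed
qed

text \<open>The one-step form of the Ando-Hiai inequality. If \<open>A # B \<le> 1\<close>, that is
  \<open>A \<le> C\<^bsup>-t\<^esup>\<close>, then \<open>A\<^sup>2 # B\<^sup>2 \<le> A # B\<close>. In general \<open>A\<close> is first lowered to some \<open>A' \<le> C\<^bsup>-t\<^esup>\<close>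
  at the cost \<open>ln det A - ln det A'\<close>, which is the positive part of \<open>ln (A # B)\<close>.\<close>

lemma ln_plus_geo_mean_square:
  fixes A B :: "complex^'n^'n"
  assumes A: "pos_def A" and B: "pos_def B" and t: "0 \<le> t" "t \<le> 1"
  shows "trace_fun ln_plus (geo_mean (A ** A) t (B ** B)) \<le> 2 * trace_fun ln_plus (geo_mean A t B)"
proof -
  define C where "C = mat_powr A (-1/2) ** B ** mat_powr A (-1/2)"
  have C: "pos_def C" unfolding C_def by (intro pos_def_cong_hermitian mat_powr_pos_def A B)
  have B_eq: "B = mat_powr A (1/2) ** C ** mat_powr A (1/2)"
    using mat_powr_sandwich_cancel(2)[OF A, of "1/2" B] by (simp add: C_def)
  define K where "K = mat_powr C (t/2) ** A ** mat_powr C (t/2)"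
  have K: "pos_def K" unfolding K_def by (intro pos_def_cong_hermitian mat_powr_pos_def A C)
  have half: "mat_powr (mat_powr C t) (1/2) = mat_powr C (t/2)" by (simp add: mat_powr_powr[OF C])
  \<comment> \<open>\<open>K\<close> has the spectrum of
    \<open>A #_t B = A^(1/2) C^t A^(1/2)\<close>, but with \<open>A\<close> in the middle, where it
    can be lowered while \<open>C\<close> stays fixed.\<close>
  have geo_K: "trace_fun f (geo_mean A t B) = trace_fun f K" for f
    unfolding geo_mean_def C_def[symmetric] K_def half[symmetric]
    by (rule trace_fun_sandwich_commute[OF A mat_powr_pos_def[OF C]])
  obtain K' where K': "pos_def K'" "K' \<preceq> K" "K' \<preceq> mat 1" "trace_fun ln_plus K' = 0"
    "trace_fun ln K - trace_fun ln K' = trace_fun ln_plus K"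
    using min_1_spectral[OF K] by blast
  define A' where "A' = mat_powr C (-t/2) ** K' ** mat_powr C (-t/2)"
  have A': "pos_def A'" unfolding A'_def by (intro pos_def_cong_hermitian mat_powr_pos_def K' C)
  have K'_eq: "K' = mat_powr C (t/2) ** A' ** mat_powr C (t/2)"
    using mat_powr_sandwich_cancel(2)[OF C, of "t/2" K'] by (simp add: A'_def)
  have A'_A: "A' \<preceq> A"
    using K'(2) unfolding K_def K'_eq by (rule loewner_le_sandwich[OF C])
  have "A' \<preceq> mat_powr C (-t/2) ** mat 1 ** mat_powr C (-t/2)"
    unfolding A'_def by (rule loewner_le_cong_hermitian[OF K'(3) mat_powr_hermitian[OF C]])
  then have A'_C: "A' \<preceq> mat_powr C (-t)" by (simp add: mat_powr_mult[OF C])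
  have det_A: "trace_fun ln A - trace_fun ln A' = trace_fun ln_plus (geo_mean A t B)"
  proof -
    have "trace_fun ln K = trace_fun ln A + t * trace_fun ln C" "trace_fun ln K' = trace_fun ln A' + t * trace_fun ln C"
      unfolding K_def K'_eq
      by (simp_all add: trace_fun_ln_sandwich[OF A mat_powr_pos_def[OF C]] trace_fun_ln_sandwich[OF A' mat_powr_pos_def[OF C]] trace_fun_ln_powr[OF C])
    then show ?thesis using K'(5) by (simp add: geo_K)
  qed
  \<comment> \<open>Since \<open>B^2 = A^(1/2) (C A C) A^(1/2)\<close>, congruence covariance gives
    \<open>A^2 #_t B^2 = A^(1/2) Q A^(1/2)\<close>; \<open>Q'\<close> is the same expression for
    \<open>A'\<close>.\<close>
  define Q where "Q = geo_mean A t (C ** A ** C)"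
  define Q' where "Q' = geo_mean A' t (C ** A' ** C)"
  have CAC: "pos_def (C ** A ** C)" "pos_def (C ** A' ** C)" by (intro pos_def_cong_hermitian A A' C)+
  have Q: "pos_def Q" "pos_def Q'" unfolding Q_def Q'_def by (intro pos_def_geo_mean A A' CAC)+
  have CC: "C ** A' ** C \<preceq> C ** A ** C" "C ** A' ** C \<preceq> C ** mat_powr C (-t) ** C"
    by (intro loewner_le_cong_hermitian A'_A A'_C pos_def_hermitian[OF C])+
  have C2: "C ** mat_powr C (-t) ** C = mat_powr C (2 - t)"
  proof -
    have "mat_powr C 1 ** mat_powr C (-t) ** mat_powr C 1 = mat_powr C (2 - t)"
      by (simp only: mat_powr_mult[OF C]) (simp add: algebra_simps)
    then show ?thesis by (simp add: mat_powr_1[OF C])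
  qed
  have Q'_Q: "Q' \<preceq> Q" unfolding Q_def Q'_def by (intro geo_mean_mono A A' A'_A CAC CC t)
  \<comment> \<open>Both arguments of the mean are raised to powers of \<open>C\<close> by means of
    \<open>A' \<preceq> C^(-t)\<close>.\<close>
  have "Q' \<preceq> geo_mean (mat_powr C (-t)) t (mat_powr C (2 - t))"
    unfolding Q'_def using CC(2) by (intro geo_mean_mono A' A'_C CAC t mat_powr_pos_def C) (simp add: C2)
  also have "\<dots> = mat_powr C t" by (simp add: geo_mean_powr[OF C]) (simp add: algebra_simps)
  finally have Q'_C: "Q' \<preceq> mat_powr C t" .
  define F where "F = geo_mean (A ** A) t (B ** B)"
  define F' where "F' = mat_powr A' (1/2) ** Q' ** mat_powr A' (1/2)"
  have F_eq: "F = mat_powr A (1/2) ** Q ** mat_powr A (1/2)"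
  proof -
    have "mat_powr A (1/2) ** A ** mat_powr A (1/2) = A ** A"
    proof -
      have "mat_powr A (1/2) ** mat_powr A 1 ** mat_powr A (1/2) = mat_powr A 1 ** mat_powr A 1"
        by (simp only: mat_powr_mult[OF A]) simp
      then show ?thesis by (simp add: mat_powr_1[OF A])
    qed
    moreover have "mat_powr A (1/2) ** (C ** A ** C) ** mat_powr A (1/2) = B ** B"
      unfolding B_eq by (simp add: matrix_mul_assoc mat_powr_mult_assoc[OF A] mat_powr_1[OF A])
    ultimately show ?thesis
      using geo_mean_congruence_pos_def[OF A CAC(1) mat_powr_pos_def[OF A], of "1/2" t] by (simp add: F_def Q_def)
  qed
  have F: "pos_def F" "pos_def F'"
    unfolding F_eq F'_def by (intro pos_def_cong_hermitian mat_powr_pos_def A A' Q)+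
  \<comment> \<open>From \<open>F'\<close> to \<open>F\<close> in two monotone moves: raise
    \<open>Q'\<close> to \<open>Q\<close> inside the sandwich, swap the factors, then raise
    \<open>A'\<close> to \<open>A\<close>.\<close>
  have "trace_fun ln_minus F' \<le> trace_fun ln_minus (mat_powr A' (1/2) ** Q ** mat_powr A' (1/2))"
    unfolding F'_def
    by (intro trace_fun_ln_parts_mono(2) pos_def_cong_hermitian loewner_le_cong_hermitian mat_powr_pos_def mat_powr_hermitian A' Q Q'_Q)
  also have "\<dots> = trace_fun ln_minus (mat_powr Q (1/2) ** A' ** mat_powr Q (1/2))"
    by (rule trace_fun_sandwich_commute[OF A' Q(1)])
  also have "\<dots> \<le> trace_fun ln_minus (mat_powr Q (1/2) ** A ** mat_powr Q (1/2))"
    by (intro trace_fun_ln_parts_mono(2) pos_def_cong_hermitian loewner_le_cong_hermitian mat_powr_pos_def mat_powr_hermitian A A' Q A'_A)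
  also have "\<dots> = trace_fun ln_minus F"
    unfolding F_eq by (rule trace_fun_sandwich_commute[OF Q(1) A])
  finally have minus: "trace_fun ln_minus F' \<le> trace_fun ln_minus F" .
  \<comment> \<open>Bounding \<open>Q'\<close> by \<open>C^t\<close> leaves a matrix with the
    spectrum of \<open>K'\<close>, hence without positive logarithms.\<close>
  have "trace_fun ln_plus F' \<le> trace_fun ln_plus (mat_powr A' (1/2) ** mat_powr C t ** mat_powr A' (1/2))"
    unfolding F'_def
    by (intro trace_fun_ln_parts_mono(1) pos_def_cong_hermitian loewner_le_cong_hermitian mat_powr_pos_def mat_powr_hermitian A' Q Q'_C C)
  also have "\<dots> = trace_fun ln_plus K'"
    unfolding trace_fun_sandwich_commute[OF A' mat_powr_pos_def[OF C]] half K'_eq ..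
  finally have plus: "trace_fun ln_plus F' \<le> 0" using K'(4) by simp
  have split: "trace_fun ln F = trace_fun ln_plus F + trace_fun ln_minus F" "trace_fun ln F' = trace_fun ln_plus F' + trace_fun ln_minus F'"
    by (intro trace_fun_ln_split pos_def_hermitian F)+
  \<comment> \<open>The terms in \<open>C\<close> agree, so the log-determinants of \<open>F\<close>
    and \<open>F'\<close> differ by twice the cost of passing from \<open>A\<close> to
    \<open>A'\<close>.\<close>
  have "trace_fun ln F = 2 * trace_fun ln A + 2 * t * trace_fun ln C" "trace_fun ln F' = 2 * trace_fun ln A' + 2 * t * trace_fun ln C"
    unfolding F_eq F'_def Q_def Q'_def
    by (simp_all add: trace_fun_ln_sandwich pos_def_geo_mean mat_powr_pos_def A A' C CAC trace_fun_ln_powr trace_fun_ln_geo_mean algebra_simps)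
  with minus plus split det_A show ?thesis unfolding F_def[symmetric] by linarith
qed

lemma ln_plus_geo_mean_root:
  assumes "0 \<le> t" "t \<le> 1" "pos_def A" "pos_def B"
  shows "trace_fun ln_plus (geo_mean A t B)
    \<le> 2 ^ m * trace_fun ln_plus (geo_mean (mat_powr A ((1/2) ^ m)) t (mat_powr B ((1/2) ^ m)))"
  using assms(3,4)
proof (induction m arbitrary: A B)
  case 0
  then show ?case by (simp add: mat_powr_1)
next
  case (Suc m)
  have sq: "mat_powr X (1/2) ** mat_powr X (1/2) = X" if "pos_def X" for X :: "complex^'a^'a"
    using that by (simp add: mat_powr_mult mat_powr_1)
  have "trace_fun ln_plus (geo_mean A t B) \<le> 2 * trace_fun ln_plus (geo_mean (mat_powr A (1/2)) t (mat_powr B (1/2)))"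
    using ln_plus_geo_mean_square[OF mat_powr_pos_def mat_powr_pos_def assms(1,2), of A B "1/2" "1/2"] Suc.prems
    by (simp add: sq)
  also have "\<dots> \<le> 2 * (2 ^ m * trace_fun ln_plus (geo_mean (mat_powr (mat_powr A (1/2)) ((1/2) ^ m)) t (mat_powr (mat_powr B (1/2)) ((1/2) ^ m))))"
    by (intro mult_left_mono Suc.IH mat_powr_pos_def Suc.prems) simp
  finally show ?case by (simp add: mat_powr_powr Suc.prems)
qed

lemma ln_plus_geo_mean_le:
  fixes A B :: "complex^'n^'n"
  assumes A: "pos_def A" and B: "pos_def B" and t: "0 \<le> t" "t \<le> 1"
    and l: "spec ((1 - t) *\<^sub>R mat_ln A + t *\<^sub>R mat_ln B) l"
  shows "trace_fun ln_plus (geo_mean A t B) \<le> (\<Sum>i\<in>UNIV. max 0 (l i))"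
proof (rule field_le_epsilon)
  fix e :: real assume "e > 0"
  \<comment> \<open>Each of the \<open>CARD('n)\<close> eigenvalues contributes an error of at most
    \<open>\<epsilon>\<close>.\<close>
  define \<epsilon> where "\<epsilon> = e / real CARD('n)"
  define L where "L = (1 - t) *\<^sub>R mat_ln A + t *\<^sub>R mat_ln B"
  have \<epsilon>: "\<epsilon> > 0" using \<open>e > 0\<close> by (simp add: \<epsilon>_def)
  have "\<forall>\<^sub>F r in at_right 0. r \<in> {0<..<1::real}"
    by (rule eventually_at_right_real) simp
  with mat_powr_le_linear[OF A \<epsilon>] mat_powr_le_linear[OF B \<epsilon>]
  have ev: "\<forall>\<^sub>F r in at_right 0. trace_fun ln_plus (geo_mean (mat_powr A r) t (mat_powr B r)) \<le> r * (\<Sum>i\<in>UNIV. max 0 (l i + \<epsilon>))"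
  proof eventually_elim
    case (elim r)
    define G where "G = geo_mean (mat_powr A r) t (mat_powr B r)"
    have G: "pos_def G" unfolding G_def by (intro pos_def_geo_mean mat_powr_pos_def A B)
    obtain g where g: "spec G g" using hermitian_spec pos_def_hermitian[OF G] by blast
    have "G \<preceq> (1 - t) *\<^sub>R mat_powr A r + t *\<^sub>R mat_powr B r"
      unfolding G_def by (intro geo_mean_le_arithmetic mat_powr_pos_def A B t)
    also have "\<dots> \<preceq> (1 - t) *\<^sub>R (mat 1 + r *\<^sub>R (mat_ln A + \<epsilon> *\<^sub>R mat 1)) + t *\<^sub>R (mat 1 + r *\<^sub>R (mat_ln B + \<epsilon> *\<^sub>R mat 1))"
      using elim(1,2) t unfolding loewner_le_def quad_form_add[of "(1 - t) *\<^sub>R _"] quad_form_scaleR[of "1 - t"] quad_form_scaleR[of t]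
      by (auto intro!: add_mono mult_left_mono)
    also have "\<dots> = r *\<^sub>R L + (1 + r * \<epsilon>) *\<^sub>R mat 1"
      by (simp add: L_def algebra_simps)
    finally have le: "G \<preceq> r *\<^sub>R L + (1 + r * \<epsilon>) *\<^sub>R mat 1" .
    have "trace_fun ln_plus G = (\<Sum>i\<in>UNIV. ln_plus (g i))" by (rule trace_fun_spec[OF g])
    \<comment> \<open>\<open>ln x \<le> x - 1\<close> trades the logarithm for a linear term. In the
      bound for \<open>G - 1\<close> all is then proportional to \<open>r\<close>, and this factor
      cancels the \<open>2^m\<close> of the doubling.\<close>
    also have "\<dots> \<le> (\<Sum>i\<in>UNIV. max 0 (g i - 1))"
    proof (rule sum_mono)
      fix i
      have "g i > 0" using spec_pos_def[OF g] G by simp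
      then show "ln_plus (g i) \<le> max 0 (g i - 1)" using ln_le_minus_one[of "g i"] by auto
    qed
    also have "\<dots> \<le> (\<Sum>i\<in>UNIV. max 0 (r * l i + (1 + r * \<epsilon>) - 1))"
      by (rule sum_spectrum_mono[OF g spec_shift[OF l] le[unfolded L_def], where g = "\<lambda>x. max 0 (x - 1)"]) auto
    also have "\<dots> = (\<Sum>i\<in>UNIV. r * max 0 (l i + \<epsilon>))"
      using elim(3) by (intro sum.cong refl) (simp add: max_mult_distrib_left distrib_left)
    finally show ?case by (simp add: G_def sum_distrib_left)
  qed
  \<comment> \<open>The doubling yields only the exponents \<open>r = (1/2)^m\<close>; they tend to
    \<open>0\<close> from the right, so one of them satisfies the eventual bound.\<close>
  have "filterlim (\<lambda>m. (1/2::real) ^ m) (at_right 0) sequentially"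
    unfolding filterlim_at by (auto intro!: LIMSEQ_power_zero)
  from eventually_compose_filterlim[OF ev this] obtain m where
    m: "trace_fun ln_plus (geo_mean (mat_powr A ((1/2) ^ m)) t (mat_powr B ((1/2) ^ m))) \<le> (1/2) ^ m * (\<Sum>i\<in>UNIV. max 0 (l i + \<epsilon>))"
    by (auto simp: eventually_sequentially)
  have "trace_fun ln_plus (geo_mean A t B) \<le> 2 ^ m * ((1/2) ^ m * (\<Sum>i\<in>UNIV. max 0 (l i + \<epsilon>)))"
    by (rule order_trans[OF ln_plus_geo_mean_root[OF t A B, of m] mult_left_mono[OF m]]) simp
  also have "\<dots> = (\<Sum>i\<in>UNIV. max 0 (l i + \<epsilon>))"
    by (simp add: power_one_over)
  also have "\<dots> \<le> (\<Sum>i\<in>UNIV. max 0 (l i) + \<epsilon>)"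
    using \<epsilon> by (intro sum_mono) auto
  also have "\<dots> = (\<Sum>i\<in>UNIV. max 0 (l i)) + e"
    by (simp add: sum.distrib \<epsilon>_def)
  finally show "trace_fun ln_plus (geo_mean A t B) \<le> (\<Sum>i\<in>UNIV. max 0 (l i)) + e" .
qed

section \<open>The remaining spectral inequalities\<close>

text \<open>In an eigenbasis of \<open>D\<close>, each diagonal entry of \<open>W\<close> is at
  least \<open>d i\<close> and at least \<open>0\<close>.\<close>

lemma trace_ge_positive_part:
  fixes D W :: "complex^'n^'n"
  assumes d: "spec D d" and DW: "D \<preceq> W" and W: "\<And>x. 0 \<le> quad_form W x"
  shows "(\<Sum>i\<in>UNIV. max 0 (d i)) \<le> Re (trace W)"
proof -
  obtain U where U: "unitary U" "D = U ** real_diag d ** adj U" using d by (auto simp: spec_def)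
  have quad_form_axis: "quad_form X (axis i 1) = Re (X $ i $ i)" for X :: "complex^'n^'n" and i
  proof -
    have "(X *v axis i 1) $ j = X $ j $ i" for j
      by (simp add: matrix_vector_mult_def axis_def if_distrib cong: if_cong)
    then show ?thesis by (simp add: quad_form_def inner_axis' inner_complex_def)
  qed
  have "max 0 (d i) \<le> Re ((adj U ** W ** U) $ i $ i)" for i
  proof -
    have "adj U ** D ** U = real_diag d" using U by (simp add: matrix_mul_assoc unitaryD)
    then have "d i = quad_form (adj U ** D ** U) (axis i 1)" by (simp add: quad_form_axis real_diag_nth)
    also have "\<dots> \<le> quad_form (adj U ** W ** U) (axis i 1)" using DW by (simp add: quad_form_cong loewner_le_def)
    finally have "d i \<le> quad_form (adj U ** W ** U) (axis i 1)" .
    moreover have "0 \<le> quad_form (adj U ** W ** U) (axis i 1)" using W by (simp add: quad_form_cong)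
    ultimately show ?thesis by (simp add: quad_form_axis)
  qed
  then have "(\<Sum>i\<in>UNIV. max 0 (d i)) \<le> Re (trace (adj U ** W ** U))"
    by (simp add: trace_def sum_mono)
  also have "trace (adj U ** W ** U) = trace W"
    using trace_mul_sym[of "adj U" "W ** U"] by (simp add: matrix_mul_assoc unitaryD[OF U(1)] flip: matrix_mul_assoc[of W])
  finally show ?thesis .
qed

lemma trace_mat_ln: "Re (trace (mat_ln A)) = trace_fun ln A"
  by (simp add: trace_fun_def mat_ln_def)

text \<open>Cut \<open>Y X Y\<close> down to \<open>M' = Y X' Y \<preceq> 1\<close>. Then
  \<open>X' \<preceq> Y^(-2)\<close>, and monotonicity of the logarithm gives
  \<open>2 ln Y \<preceq> - ln X'\<close>, so the left matrix is at most
  \<open>ln X - ln X'\<close>. This bound is nonnegative because \<open>X' \<preceq> X\<close>, and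
  its trace is the cost of the cut.\<close>

lemma ln_sum_le_sandwich:
  fixes X Y :: "complex^'n^'n"
  assumes X: "pos_def X" and Y: "pos_def Y" and l: "spec (mat_ln X + 2 *\<^sub>R mat_ln Y) l"
  shows "(\<Sum>i\<in>UNIV. max 0 (l i)) \<le> trace_fun ln_plus (Y ** X ** Y)"
proof -
  have M: "pos_def (Y ** X ** Y)" by (rule pos_def_cong_hermitian[OF X Y])
  obtain M' where M': "pos_def M'" "M' \<preceq> Y ** X ** Y" "M' \<preceq> mat 1"
    "trace_fun ln (Y ** X ** Y) - trace_fun ln M' = trace_fun ln_plus (Y ** X ** Y)"
    using min_1_spectral[OF M] by blast
  define X' where "X' = mat_powr Y (-1) ** M' ** mat_powr Y (-1)"
  have X': "pos_def X'" unfolding X'_def by (intro pos_def_cong_hermitian mat_powr_pos_def Y M')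
  have M'_eq: "M' = Y ** X' ** Y"
    using mat_powr_sandwich_cancel(2)[OF Y, of 1 M'] by (simp add: X'_def mat_powr_1[OF Y])
  have "X' \<preceq> X"
    by (rule loewner_le_sandwich[OF Y, of 1]) (use M'(2) in \<open>simp add: mat_powr_1[OF Y] M'_eq\<close>)
  then have XX': "mat_ln X' \<preceq> mat_ln X" by (rule mat_ln_mono[OF X' X])
  have "X' \<preceq> mat_powr Y (-1) ** mat 1 ** mat_powr Y (-1)"
    unfolding X'_def by (intro loewner_le_cong_hermitian M' mat_powr_hermitian Y)
  then have "X' \<preceq> mat_powr Y (-2)" by (simp add: mat_powr_mult[OF Y])
  from mat_ln_mono[OF X' mat_powr_pos_def[OF Y] this]
  have le: "mat_ln X' \<preceq> (-2) *\<^sub>R mat_ln Y" by (simp add: mat_ln_powr[OF Y])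
  have "mat_ln X + 2 *\<^sub>R mat_ln Y \<preceq> mat_ln X - mat_ln X'"
    unfolding loewner_le_def
  proof
    fix x
    have "quad_form (mat_ln X') x \<le> (-2) * quad_form (mat_ln Y) x"
      using le unfolding loewner_le_def quad_form_scaleR by blast
    then show "quad_form (mat_ln X + 2 *\<^sub>R mat_ln Y) x \<le> quad_form (mat_ln X - mat_ln X') x"
      by (simp only: quad_form_add quad_form_diff quad_form_scaleR)
  qed
  then have "(\<Sum>i\<in>UNIV. max 0 (l i)) \<le> Re (trace (mat_ln X - mat_ln X'))"
    by (rule trace_ge_positive_part[OF l]) (use XX' in \<open>simp add: loewner_le_def quad_form_diff\<close>)
  also have "\<dots> = trace_fun ln X - trace_fun ln X'" by (simp add: trace_sub trace_mat_ln)
  also have "\<dots> = trace_fun ln_plus (Y ** X ** Y)"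
    using M'(4) by (simp add: M'_eq trace_fun_ln_sandwich X X' Y)
  finally show ?thesis .
qed

text \<open>In an eigenbasis of \<open>S\<close> the equation decouples into entries, with
  denominators \<open>s i + s j > 0\<close>.\<close>

lemma lyapunov_exists:
  fixes S K :: "complex^'n^'n"
  assumes S: "pos_def S" and K: "hermitian K"
  obtains X where "hermitian X" "X ** S + S ** X = 2 *\<^sub>R K"
proof -
  obtain U s where U: "unitary U" "S = U ** real_diag s ** adj U" "\<And>i. s i > 0"
    using pos_def_spectral[OF S] by blast
  define k where "k = adj U ** K ** U"
  have hk: "hermitian k" unfolding k_def by (rule hermitian_cong[OF K])
  define Z :: "complex^'n^'n" where "Z = (\<chi> i j. 2 * k $ i $ j / complex_of_real (s i + s j))"
  have "cnj (k $ i $ j) = k $ j $ i" for i j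
  proof -
    have "adj k $ j $ i = k $ j $ i" using hk by (simp add: hermitian_def)
    then show ?thesis by (simp add: adj_def)
  qed
  then have hZ: "hermitian Z" by (simp add: hermitian_def adj_def Z_def vec_eq_iff add.commute)
  have "Z ** real_diag s + real_diag s ** Z = 2 *\<^sub>R k"
  proof -
    have "s i + s j \<noteq> 0" for i j using U(3)[of i] U(3)[of j] by simp
    then have nz: "complex_of_real (s i + s j) \<noteq> 0" for i j by (simp only: of_real_eq_0_iff) simp
    have "Z $ i $ j * complex_of_real (s j) + complex_of_real (s i) * Z $ i $ j = 2 *\<^sub>R k $ i $ j" for i j
    proof -
      have "Z $ i $ j * complex_of_real (s j) + complex_of_real (s i) * Z $ i $ j
          = Z $ i $ j * complex_of_real (s i + s j)" by (simp add: algebra_simps)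
      then show ?thesis using nz[of i j] by (simp add: Z_def scaleR_conv_of_real[where 'a = complex])
    qed
    then show ?thesis by (simp add: vec_eq_iff mult_real_diag_nth real_diag_mult_nth)
  qed
  then have "U ** (Z ** real_diag s + real_diag s ** Z) ** adj U = 2 *\<^sub>R (U ** k ** adj U)"
    by (simp add: matrix_mult_distribs)
  moreover have "U ** k ** adj U = K" by (simp add: k_def matrix_mul_assoc unitaryD[OF U(1)])
  ultimately have "(U ** Z ** adj U) ** S + S ** (U ** Z ** adj U) = 2 *\<^sub>R K"
    by (simp add: U(2) unitary_conj_mult[OF U(1)] matrix_mult_distribs)
  then show thesis using that hermitian_cong'[OF hZ] by blast
qed

text \<open>At an eigenvector \<open>u\<close> of \<open>X\<close> with eigenvalue
  \<open>d i\<close>, the form of \<open>X S + S X\<close> is \<open>2 d i\<close> times the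
  positive number \<open>quad_form S u\<close>.\<close>

lemma lyapunov_psd:
  fixes S X :: "complex^'n^'n"
  assumes S: "pos_def S" and X: "hermitian X" and pos: "\<And>x. 0 \<le> quad_form (X ** S + S ** X) x"
  shows "0 \<le> quad_form X x"
proof -
  obtain U d where U: "unitary U" "X = U ** real_diag d ** adj U" by (rule spectral[OF X])
  have "d i \<ge> 0" for i
  proof -
    define u where "u = U *v axis i 1"
    have "u \<noteq> 0" unfolding u_def
      by (rule inj_of_left_inverse[OF unitaryD(1)[OF U(1)]]) (simp add: axis_eq_0_iff)
    then have q: "quad_form S u > 0" using S by (simp add: pos_def_iff)
    have "real_diag d *v axis i 1 = d i *\<^sub>R (axis i 1 :: complex^'n)"
      by (simp add: vec_eq_iff real_diag_vec axis_def scaleR_conv_of_real[where 'a = complex])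
    then have Xu: "X *v u = d i *\<^sub>R u"
      using unitaryD(3)[OF U(1), of "U ** real_diag d"]
      by (simp add: u_def U(2) matrix_vector_mul_assoc flip: matrix_vector_scaleR_right)
        (simp flip: matrix_vector_mul_assoc)
    have "quad_form (X ** S + S ** X) u = 2 * (d i * quad_form S u)"
      by (simp add: quad_form_add) (simp add: quad_form_def hermitian_inner[OF X] Xu matrix_vector_scaleR_right flip: matrix_vector_mul_assoc)
    then show ?thesis using pos[of u] q by (simp add: zero_le_mult_iff)
  qed
  then show ?thesis unfolding U(2) quad_form_unitary_diag by (simp add: sum_nonneg)
qed

text \<open>The map sending \<open>H\<close> to \<open>S\<^bsup>1/2\<^esup> X S\<^bsup>1/2\<^esup>\<close>, where \<open>X S + S X = 2 H\<close>, is positive, unital and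
  trace preserving; apply it to \<open>H - c \<le> (H - c)\<^sup>+\<close>.\<close>

lemma sandwich_majorized_real_part:
  fixes X S :: "complex^'n^'n"
  assumes X: "hermitian X" and S: "pos_def S"
    and d: "spec (mat_powr S (1/2) ** X ** mat_powr S (1/2)) d"
    and h: "spec ((1/2) *\<^sub>R (X ** S + S ** X)) h"
  shows "(\<Sum>i\<in>UNIV. max 0 (d i - c)) \<le> (\<Sum>i\<in>UNIV. max 0 (h i - c))"
proof -
  define Y where "Y = mat_powr S (1/2)"
  have Y: "hermitian Y" unfolding Y_def by (rule mat_powr_hermitian[OF S])
  have YY: "Y ** Y = S" "N ** Y ** Y = N ** S" for N
    by (simp_all add: Y_def mat_powr_mult[OF S] mat_powr_mult_assoc[OF S] mat_powr_1[OF S])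
  obtain V where V: "unitary V" "(1/2) *\<^sub>R (X ** S + S ** X) = V ** real_diag h ** adj V"
    using h by (auto simp: spec_def)
  define K where "K = V ** real_diag (\<lambda>i. max 0 (h i - c)) ** adj V"
  have "hermitian K" unfolding K_def by (rule hermitian_cong') simp
  then obtain X1 where X1: "hermitian X1" "X1 ** S + S ** X1 = 2 *\<^sub>R K"
    by (rule lyapunov_exists[OF S])
  have X1_pos: "0 \<le> quad_form X1 x" for x
    by (rule lyapunov_psd[OF S X1(1)])
      (simp add: X1(2) quad_form_scaleR K_def quad_form_unitary_diag sum_nonneg)
  \<comment> \<open>\<open>c S^(-1)\<close> is the Lyapunov solution for the right side
    \<open>c\<close>. So \<open>D\<close> is the solution for \<open>K - H + c\<close>, where
    \<open>H\<close> is half of \<open>X S + S X\<close>; this right side is the negative part of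
    \<open>H - c\<close>, hence nonnegative.\<close>
  define D where "D = X1 - X + c *\<^sub>R mat_powr S (-1)"
  have "D ** S + S ** D = 2 *\<^sub>R (K - (1/2) *\<^sub>R (X ** S + S ** X) + c *\<^sub>R mat 1)"
  proof -
    have "D ** S + S ** D = (X1 ** S + S ** X1) - (X ** S + S ** X)
        + c *\<^sub>R (mat_powr S (-1) ** S + S ** mat_powr S (-1))"
      by (simp add: D_def matrix_mult_distribs algebra_simps)
    moreover have "mat_powr S (-1) ** S = mat 1" "S ** mat_powr S (-1) = mat 1"
      using mat_powr_inverse[OF S, of 1] by (simp_all add: mat_powr_1[OF S])
    ultimately have "D ** S + S ** D = 2 *\<^sub>R K - (X ** S + S ** X) + c *\<^sub>R (mat 1 + mat 1)"
      by (simp only: X1(2))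
    moreover have "c *\<^sub>R (mat 1 + mat 1) = (2 * c) *\<^sub>R (mat 1 :: complex^'n^'n)"
      by (simp only: scaleR_2[symmetric] scaleR_scaleR mult.commute)
    ultimately show ?thesis by (simp add: scaleR_add_right scaleR_diff_right)
  qed
  also have "\<dots> = 2 *\<^sub>R (V ** real_diag (\<lambda>i. max 0 (h i - c) - h i + c * 1) ** adj V)"
    unfolding real_diag_add[symmetric] real_diag_diff[symmetric] real_diag_scaleR[symmetric]
      matrix_mult_distribs unitary_conj_1[OF V(1)] V(2) K_def ..
  finally have DS: "D ** S + S ** D = 2 *\<^sub>R (V ** real_diag (\<lambda>i. max 0 (h i - c) - h i + c * 1) ** adj V)" .
  have "hermitian D" unfolding D_def
    by (intro hermitian_add hermitian_diff hermitian_scaleR X X1 mat_powr_hermitian S)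
  then have D_pos: "0 \<le> quad_form D x" for x
    by (rule lyapunov_psd[OF S]) (simp add: DS quad_form_scaleR quad_form_unitary_diag, intro sum_nonneg mult_nonneg_nonneg, auto)
  define W where "W = Y ** X1 ** Y"
  have conj: "quad_form (Y ** M ** Y) x = quad_form M (Y *v x)" for M x
    using quad_form_cong[of Y M x] Y by (simp add: hermitian_def)
  have "Y ** D ** Y = W - Y ** X ** Y + c *\<^sub>R mat 1"
  proof -
    have "Y ** mat_powr S (-1) ** Y = mat 1"
      by (simp add: Y_def mat_powr_mult[OF S] mat_powr_0[OF S])
    then show ?thesis by (simp add: D_def W_def matrix_mult_distribs)
  qed
  then have "quad_form (Y ** X ** Y) x \<le> quad_form (W + c *\<^sub>R mat 1) x" for x
    using D_pos[of "Y *v x"] conj[of D x] by (simp add: quad_form_add quad_form_diff)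
  then have le: "1 *\<^sub>R (Y ** X ** Y) + (- c) *\<^sub>R mat 1 \<preceq> W"
    by (simp add: loewner_le_def quad_form_add quad_form_diff quad_form_scaleR algebra_simps)
  have "(\<Sum>i\<in>UNIV. max 0 (1 * d i + - c)) \<le> Re (trace W)"
    by (rule trace_ge_positive_part[OF spec_shift[OF d[folded Y_def]] le]) (simp add: W_def conj X1_pos)
  also have "trace W = trace (X1 ** S)"
    using trace_mul_sym[of Y "X1 ** Y"] by (simp add: W_def matrix_mul_assoc YY)
  \<comment> \<open>Trace preservation: the trace of \<open>X1 S + S X1\<close> is twice that of
    \<open>X1 S\<close>.\<close>
  also have "Re \<dots> = Re (trace K)"
  proof -
    have "trace (X1 ** S + S ** X1) = trace (K + K)" by (simp add: X1(2) scaleR_2)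
    then have "trace (X1 ** S) + trace (X1 ** S) = trace K + trace K"
      by (simp only: trace_add trace_mul_sym[of S])
    then show ?thesis by simp
  qed
  also have "\<dots> = (\<Sum>i\<in>UNIV. max 0 (h i - c))" by (simp add: K_def trace_unitary_diag[OF V(1)])
  finally show ?thesis by simp
qed

text \<open>The concave \<open>x^(2-2t)\<close> lies below its tangent at \<open>1\<close>, the
  convex \<open>x^(-2t)\<close> above its own. Half of each slope gives the weights
  \<open>1 - t\<close> and \<open>t\<close>, and the constants \<open>t - 1/2\<close> and
  \<open>-t - 1/2\<close> sum to \<open>-1\<close>.\<close>

lemma young_operator:
  fixes A B :: "complex^'n^'n"
  assumes A: "pos_def A" and B: "pos_def B" and t: "1/2 \<le> t" "t \<le> 1"
  shows "(1/2) *\<^sub>R (mat_powr A (2 - 2 * t) - mat_powr B (- (2 * t))) \<preceq> (1 - t) *\<^sub>R A + t *\<^sub>R B - mat 1"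
proof -
  have a: "(1/2) *\<^sub>R mat_powr A (2 - 2 * t) \<preceq> (1 - t) *\<^sub>R A + (t - 1/2) *\<^sub>R mat 1"
  proof -
    obtain U d where U: "unitary U" "A = U ** real_diag d ** adj U" "\<And>i. d i > 0"
      using pos_def_spectral[OF A] by blast
    have "(1/2) * d i powr (2 - 2 * t) \<le> (1 - t) * d i + (t - 1/2) * 1" for i
      using Youngs_inequality_0[of "2 * t - 1" "2 - 2 * t" 1 "d i"] t U(3)[of i] by (simp add: algebra_simps)
    then have "U ** real_diag (\<lambda>i. (1/2) * d i powr (2 - 2 * t)) ** adj U
        \<preceq> U ** real_diag (\<lambda>i. (1 - t) * d i + (t - 1/2) * 1) ** adj U"
      by (intro loewner_le_cong' loewner_le_real_diag)
    then show ?thesis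
      unfolding real_diag_add[symmetric] real_diag_scaleR[symmetric] matrix_mult_distribs
        unitary_conj_1[OF U(1)] mat_powr_eq[OF U(1,2), symmetric] U(2)[symmetric] .
  qed
  have b: "(- (1/2)) *\<^sub>R mat_powr B (- (2 * t)) \<preceq> t *\<^sub>R B + (- t - 1/2) *\<^sub>R mat 1"
  proof -
    obtain U d where U: "unitary U" "B = U ** real_diag d ** adj U" "\<And>i. d i > 0"
      using pos_def_spectral[OF B] by blast
    have "(- (1/2)) * d i powr (- (2 * t)) \<le> t * d i + (- t - 1/2) * 1" for i
    proof -
      have "1 + (- (2 * t)) * ln (d i) \<le> exp ((- (2 * t)) * ln (d i))" by (rule exp_ge_add_one_self)
      moreover have "t * ln (d i) \<le> t * (d i - 1)"
        using t U(3)[of i] by (intro mult_left_mono ln_le_minus_one) auto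
      ultimately show ?thesis using U(3)[of i] by (simp add: powr_def algebra_simps)
    qed
    then have "U ** real_diag (\<lambda>i. (- (1/2)) * d i powr (- (2 * t))) ** adj U
        \<preceq> U ** real_diag (\<lambda>i. t * d i + (- t - 1/2) * 1) ** adj U"
      by (intro loewner_le_cong' loewner_le_real_diag)
    then show ?thesis
      unfolding real_diag_add[symmetric] real_diag_scaleR[symmetric] matrix_mult_distribs
        unitary_conj_1[OF U(1)] mat_powr_eq[OF U(1,2), symmetric] U(2)[symmetric] .
  qed
  have "quad_form ((1/2) *\<^sub>R (mat_powr A (2 - 2 * t) - mat_powr B (- (2 * t)))) x \<le> quad_form ((1 - t) *\<^sub>R A + t *\<^sub>R B - mat 1) x" for x
    using a[unfolded loewner_le_def, rule_format, of x] b[unfolded loewner_le_def, rule_format, of x]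
    by (simp add: quad_form_add quad_form_diff quad_form_scaleR quad_form_minus algebra_simps)
  then show ?thesis by (simp add: loewner_le_def)
qed

text \<open>Here \<open>\<sigma>\<close> lists the singular values of \<open>A\<^bsup>1-t\<^esup> B\<^sup>t\<close>.\<close>

lemma young_singular_values:
  fixes A B :: "complex^'n^'n"
  assumes A: "pos_def A" and B: "pos_def B" and t: "1/2 \<le> t" "t \<le> 1"
    and \<sigma>: "spec (mat_powr B t ** mat_powr A (2 - 2 * t) ** mat_powr B t) (\<lambda>i. (\<sigma> i)\<^sup>2)" "\<And>i. \<sigma> i > 0"
    and \<mu>: "spec ((1 - t) *\<^sub>R A + t *\<^sub>R B) \<mu>"
  shows "(\<Sum>i\<in>UNIV. max 0 (\<sigma> i - c)) \<le> (\<Sum>i\<in>UNIV. max 0 (\<mu> i - c))"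
proof (rule sum_le_of_card_le[where g = "\<lambda>x. max 0 (x - c)"])
  fix s :: real
  have pos: "pos_def ((1 - t) *\<^sub>R A + t *\<^sub>R B)"
  proof (cases "t = 1")
    case False
    then show ?thesis using A B t by (intro pos_def_add pos_def_scaleR) auto
  qed (use B in simp)
  show "card {i \<in> UNIV. s \<le> \<sigma> i} \<le> card {j \<in> UNIV. s \<le> \<mu> j}"
  proof (cases "s > 0")
    \<comment> \<open>At a level \<open>s \<le> 0\<close> every \<open>\<mu> j\<close> counts, being
      positive.\<close>
    case False
    have "s \<le> \<mu> j" for j
    proof -
      have "\<mu> j > 0" using spec_pos_def[OF \<mu>] pos by simp
      then show ?thesis using False by simp
    qed
    then show ?thesis by (intro card_mono) auto
  next
    case s: True
    let ?Z = "mat_powr B t ** mat_powr A (2 - 2 * t) ** mat_powr B t"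
    \<comment> \<open>Under \<open>y = B^t x\<close>, the condition that the form of
      \<open>?Z - s^2\<close> is nonnegative at \<open>x\<close> compares \<open>A^(2-2t)\<close>
      with \<open>s^2 B^(-2t)\<close> at \<open>y\<close>.\<close>
    have "card {i. 0 \<le> 1 * (\<sigma> i)\<^sup>2 + - (s\<^sup>2)} \<le> card {j. 0 \<le> 1 * \<mu> j + - s}"
    proof (rule card_spectrum_le[OF spec_shift[OF \<sigma>(1)] spec_shift[OF \<mu>], where R = "mat_powr B t"])
      fix x :: "complex^'n"
      assume x: "x \<noteq> 0" "0 \<le> quad_form (1 *\<^sub>R ?Z + (- (s\<^sup>2)) *\<^sub>R mat 1) x"
      define y where "y = mat_powr B t *v x"
      have "y \<noteq> 0" unfolding y_def by (rule inj_of_left_inverse[OF mat_powr_inverse(2)[OF B, of t] x(1)])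
      have "quad_form ?Z x = quad_form (mat_powr A (2 - 2 * t)) y"
        using quad_form_cong[of "mat_powr B t" "mat_powr A (2 - 2 * t)" x] mat_powr_hermitian[OF B, of t]
        by (simp add: y_def hermitian_def)
      moreover have "quad_form (mat_powr B (- (2 * t))) y = x \<bullet> x"
        by (simp add: quad_form_def y_def inner_powr[OF B] matrix_vector_mul_assoc mat_powr_mult[OF B] mat_powr_0[OF B])
      ultimately have q: "s\<^sup>2 * quad_form (mat_powr B (- (2 * t))) y \<le> quad_form (mat_powr A (2 - 2 * t)) y"
        using x(2) unfolding quad_form_shift by simp
      \<comment> \<open>Scaling \<open>A\<close> and \<open>B\<close> by \<open>1/s\<close> reduces
        the level to \<open>1\<close>: the two powers pick up factors whose ratio is
        \<open>r^2 = 1/s^2\<close>.\<close>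
      define r where "r = 1 / s"
      have r: "r > 0" using s by (simp add: r_def)
      have "quad_form ((1/2) *\<^sub>R (mat_powr (r *\<^sub>R A) (2 - 2 * t) - mat_powr (r *\<^sub>R B) (- (2 * t)))) y
          \<le> quad_form ((1 - t) *\<^sub>R (r *\<^sub>R A) + t *\<^sub>R (r *\<^sub>R B) - mat 1) y"
        using young_operator[OF pos_def_scaleR[OF A r] pos_def_scaleR[OF B r] t] by (simp add: loewner_le_def)
      moreover have "0 \<le> quad_form ((1/2) *\<^sub>R (mat_powr (r *\<^sub>R A) (2 - 2 * t) - mat_powr (r *\<^sub>R B) (- (2 * t)))) y"
      proof -
        have "r powr (- (2 * t)) * quad_form (mat_powr B (- (2 * t))) y = r powr (2 - 2 * t) * (s\<^sup>2 * quad_form (mat_powr B (- (2 * t))) y)"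
        proof -
          have "r powr (2 - 2 * t) = r powr (- (2 * t)) * r powr 2"
            by (simp flip: powr_add)
          also have "r powr 2 = r\<^sup>2" using r by simp
          finally have "r powr (2 - 2 * t) * s\<^sup>2 = r powr (- (2 * t)) * (r\<^sup>2 * s\<^sup>2)" by simp
          also have "r\<^sup>2 * s\<^sup>2 = 1" using s by (simp add: r_def power_divide)
          finally show ?thesis by (simp add: algebra_simps)
        qed
        also have "\<dots> \<le> r powr (2 - 2 * t) * quad_form (mat_powr A (2 - 2 * t)) y"
          by (intro mult_left_mono q) simp
        finally show ?thesis
          by (simp add: quad_form_scaleR quad_form_diff mat_powr_scaleR[OF A r] mat_powr_scaleR[OF B r])
      qed
      ultimately have "0 \<le> r * quad_form ((1 - t) *\<^sub>R A + t *\<^sub>R B) y - y \<bullet> y"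
        by (simp add: quad_form_diff quad_form_add quad_form_scaleR quad_form_mat_1 algebra_simps)
      then have "0 \<le> quad_form ((1 - t) *\<^sub>R A + t *\<^sub>R B) y - s * (y \<bullet> y)"
        using s by (simp add: r_def field_simps)
      then show "mat_powr B t *v x \<noteq> 0 \<and> 0 \<le> quad_form (1 *\<^sub>R ((1 - t) *\<^sub>R A + t *\<^sub>R B) + (- s) *\<^sub>R mat 1) (mat_powr B t *v x)"
        using \<open>y \<noteq> 0\<close> unfolding quad_form_shift y_def[symmetric] by simp
    qed
    moreover have "0 \<le> 1 * (\<sigma> i)\<^sup>2 + - (s\<^sup>2) \<longleftrightarrow> s \<le> \<sigma> i" for i
      using s \<sigma>(2)[of i] by (simp add: power2_le_iff_abs_le)
    ultimately show ?thesis by simp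
  qed
qed auto

section \<open>Majorization and unitarily invariant norms\<close>

text \<open>Abel summation in layers: \<open>z\<close> is a nonnegative combination of indicators of
  its strict level sets. Each induction step peels off the smallest positive value \<open>m\<close>
  on the support, and the level sets of the rest are those of \<open>z\<close> shifted by
  \<open>m\<close>.\<close>

lemma sum_level_sets_nonneg:
  fixes z h :: "'a::finite \<Rightarrow> real"
  assumes "\<And>i. 0 \<le> z i" and "\<And>\<tau>. 0 \<le> \<tau> \<Longrightarrow> 0 \<le> (\<Sum>i | \<tau> < z i. h i)"
  shows "0 \<le> (\<Sum>i\<in>UNIV. z i * h i)"
  using assms
proof (induction "card {i. 0 < z i}" arbitrary: z rule: less_induct)
  case less
  show ?case
  proof (cases "{i. 0 < z i} = {}")
    case True
    then have "z i = 0" for i using less.prems(1)[of i] by (simp add: order_antisym not_less)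
    then show ?thesis by simp
  next
    case False
    define S where "S = {i. 0 < z i}"
    define m where "m = Min (z ` S)"
    have "m \<in> z ` S" unfolding m_def using False S_def by (intro Min_in) auto
    then obtain k where k: "k \<in> S" "z k = m" by auto
    have m: "m > 0" using k by (simp add: S_def)
    have mS: "m \<le> z i" if "i \<in> S" for i unfolding m_def using that by simp
    define z' where "z' = (\<lambda>i. if i \<in> S then z i - m else 0)"
    have z'_iff: "\<tau> < z' i \<longleftrightarrow> \<tau> + m < z i" if "0 \<le> \<tau>" for \<tau> i
      using that m by (auto simp: z'_def S_def)
    have "0 \<le> (\<Sum>i\<in>UNIV. z' i * h i)"
    proof (rule less.hyps)
      show "card {i. 0 < z' i} < card {i. 0 < z i}"
      proof (rule psubset_card_mono)
        have "k \<in> {i. 0 < z i}" "k \<notin> {i. 0 < z' i}" using k by (auto simp: z'_def S_def)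
        moreover have "{i. 0 < z' i} \<subseteq> {i. 0 < z i}" using m by (auto simp: z'_iff)
        ultimately show "{i. 0 < z' i} \<subset> {i. 0 < z i}" by blast
      qed simp
      show "0 \<le> z' i" for i using mS by (simp add: z'_def)
      show "0 \<le> (\<Sum>i | \<tau> < z' i. h i)" if "0 \<le> \<tau>" for \<tau>
        using less.prems(2)[of "\<tau> + m"] m that by (simp add: z'_iff)
    qed
    moreover have "0 \<le> m * (\<Sum>i\<in>S. h i)" using less.prems(2)[of 0] m by (simp add: S_def)
    moreover have "(\<Sum>i\<in>UNIV. z i * h i) = (\<Sum>i\<in>UNIV. z' i * h i) + m * (\<Sum>i\<in>S. h i)"
    proof -
      have "z i * h i = z' i * h i + (if i \<in> S then m * h i else 0)" for i
        using less.prems(1)[of i] by (auto simp: z'_def S_def algebra_simps)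
      then show ?thesis by (simp add: sum.distrib sum.If_cases sum_distrib_left)
    qed
    ultimately show ?thesis by linarith
  qed
qed

text \<open>Take a permutation that maximises the pairing of \<open>a\<close> with \<open>v\<close>;
  a wrongly ordered pair could be swapped to increase it.\<close>

lemma rearrangement_sorted:
  fixes a v :: "'n::finite \<Rightarrow> real"
  obtains \<pi> where "\<pi> permutes UNIV" "\<And>i j. a i < a j \<Longrightarrow> v (\<pi> i) \<le> v (\<pi> j)"
proof -
  define f where "f \<pi> = (\<Sum>i\<in>UNIV. a i * v (\<pi> i))" for \<pi>
  have fin: "finite {\<pi>::'n \<Rightarrow> 'n. \<pi> permutes UNIV}" by (rule finite_permutations) simp
  have "Max (f ` {\<pi>. \<pi> permutes UNIV}) \<in> f ` {\<pi>. \<pi> permutes UNIV}"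
    using fin by (intro Max_in) (auto intro: exI[of _ id] permutes_id)
  then obtain \<pi> where \<pi>: "\<pi> permutes UNIV" "f \<pi> = Max (f ` {\<pi>. \<pi> permutes UNIV})" by auto
  have max: "f \<rho> \<le> f \<pi>" if "\<rho> permutes UNIV" for \<rho>
    unfolding \<pi>(2) using fin that by simp
  have "v (\<pi> i) \<le> v (\<pi> j)" if ij: "a i < a j" for i j
  proof (rule ccontr)
    assume neg: "\<not> ?thesis"
    have ne: "i \<noteq> j" using ij by auto
    define \<rho> where "\<rho> = \<pi> \<circ> Transposition.transpose i j"
    have \<rho>: "\<rho> permutes UNIV" unfolding \<rho>_def
      by (intro permutes_compose \<pi> permutes_swap_id) auto
    have split: "(\<Sum>k\<in>UNIV. g k) = g i + (g j + (\<Sum>k\<in>UNIV - {i} - {j}. g k))" for g :: "'n \<Rightarrow> real"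
      using ne by (simp add: sum.remove[of UNIV i] sum.remove[of "UNIV - {i}" j])
    have "f \<rho> - f \<pi> = (a j - a i) * (v (\<pi> i) - v (\<pi> j))"
    proof -
      have "(\<Sum>k\<in>UNIV - {i} - {j}. a k * v (\<rho> k)) = (\<Sum>k\<in>UNIV - {i} - {j}. a k * v (\<pi> k))"
        by (intro sum.cong refl) (simp add: \<rho>_def transpose_def)
      then show ?thesis unfolding f_def split by (simp add: \<rho>_def algebra_simps)
    qed
    also have "\<dots> > 0" using ij neg by simp
    finally show False using max[OF \<rho>] by simp
  qed
  with \<pi>(1) show thesis by (rule that)
qed

text \<open>By layers it suffices to treat a level set \<open>S\<close> of \<open>a\<close>. There
  \<open>v\<close> composed with \<open>\<pi>\<close> takes its largest values, so with
  \<open>s\<close> the smallest of them the sum of \<open>(v - s)^+\<close> is attained on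
  \<open>S\<close> alone, and the hypothesis at \<open>c = s\<close> applies.\<close>

lemma weak_majorization_pairing:
  fixes a u v :: "'n::finite \<Rightarrow> real"
  assumes maj: "\<And>c. (\<Sum>i\<in>UNIV. max 0 (u i - c)) \<le> (\<Sum>i\<in>UNIV. max 0 (v i - c))"
    and a: "\<And>i. 0 \<le> a i" and \<pi>: "\<pi> permutes UNIV"
    and sorted: "\<And>i j. a i < a j \<Longrightarrow> v (\<pi> i) \<le> v (\<pi> j)"
  shows "(\<Sum>i\<in>UNIV. a i * u i) \<le> (\<Sum>i\<in>UNIV. a i * v (\<pi> i))"
proof -
  have "0 \<le> (\<Sum>i\<in>UNIV. a i * (v (\<pi> i) - u i))"
  proof (rule sum_level_sets_nonneg[OF a])
    fix \<tau> :: real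
    define S where "S = {i. \<tau> < a i}"
    show "0 \<le> (\<Sum>i | \<tau> < a i. v (\<pi> i) - u i)"
    proof (cases "S = {}")
      case False
      define s where "s = Min ((\<lambda>i. v (\<pi> i)) ` S)"
      have "s \<in> (\<lambda>i. v (\<pi> i)) ` S" unfolding s_def using False by (intro Min_in) auto
      then obtain k where k: "k \<in> S" "s = v (\<pi> k)" by auto
      have in_S: "s \<le> v (\<pi> i)" if "i \<in> S" for i unfolding s_def using that by simp
      have out_S: "v (\<pi> i) \<le> s" if "i \<notin> S" for i
        unfolding k(2) using that k(1) by (intro sorted) (simp add: S_def)
      have "(\<Sum>i\<in>S. u i - s) \<le> (\<Sum>i\<in>S. max 0 (u i - s))" by (intro sum_mono) simp
      also have "\<dots> \<le> (\<Sum>i\<in>UNIV. max 0 (u i - s))" by (intro sum_mono2) auto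
      also have "\<dots> \<le> (\<Sum>i\<in>UNIV. max 0 (v i - s))" by (rule maj)
      also have "\<dots> = (\<Sum>i\<in>UNIV. max 0 (v (\<pi> i) - s))"
        using sum.permute[OF \<pi>, of "\<lambda>i. max 0 (v i - s)"] by (simp add: comp_def)
      also have "\<dots> = (\<Sum>i\<in>S. max 0 (v (\<pi> i) - s))"
        using out_S by (intro sum.mono_neutral_right) auto
      also have "\<dots> = (\<Sum>i\<in>S. v (\<pi> i) - s)" using in_S by (intro sum.cong) auto
      finally show ?thesis by (simp add: sum_subtractf S_def)
    qed (simp add: S_def)
  qed
  then show ?thesis by (simp add: right_diff_distrib sum_subtractf)
qed

text \<open>If the hull of the permutations of \<open>v\<close> missed the orthant \<open>T\<close>
  above \<open>u\<close>, a hyperplane would separate them. Its normal \<open>a\<close> is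
  nonnegative because \<open>T\<close> is unbounded in the positive directions, and this contradicts
  the pairing inequality.\<close>

lemma weak_majorization_hull:
  fixes u v :: "'n::finite \<Rightarrow> real"
  assumes maj: "\<And>c. (\<Sum>i\<in>UNIV. max 0 (u i - c)) \<le> (\<Sum>i\<in>UNIV. max 0 (v i - c))"
  obtains Q :: "(real^'n) set" and \<theta> where "finite Q" "\<And>q. q \<in> Q \<Longrightarrow> \<exists>\<pi>. \<pi> permutes UNIV \<and> (\<forall>i. q $ i = v (\<pi> i))"
    "\<And>q. q \<in> Q \<Longrightarrow> 0 \<le> \<theta> q" "sum \<theta> Q = 1" "\<And>i. u i \<le> (\<Sum>q\<in>Q. \<theta> q * q $ i)"
proof -
  define Q :: "(real^'n) set" where "Q = (\<lambda>\<pi>. \<chi> i. v (\<pi> i)) ` {\<pi>. \<pi> permutes UNIV}"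
  define T :: "(real^'n) set" where "T = {w. \<forall>i. u i \<le> w $ i}"
  have fin: "finite Q" unfolding Q_def by (intro finite_imageI finite_permutations) simp
  have "Q \<noteq> {}" unfolding Q_def using permutes_id by blast
  have T: "convex T" "closed T"
  proof -
    have "T = (\<Inter>i. {w. w $ i \<ge> u i})" by (auto simp: T_def)
    then show "closed T" by (auto intro!: closed_INT closed_Collect_le continuous_intros)
    show "convex T"
    proof (rule convexI)
      fix x y :: "real^'n" and p q :: real
      assume xy: "x \<in> T" "y \<in> T" and pq: "0 \<le> p" "0 \<le> q" "p + q = 1"
      have "u i \<le> p * x $ i + q * y $ i" for i
      proof -
        have "u i = p * u i + q * u i" using pq(3) by (simp flip: distrib_right)
        also have "\<dots> \<le> p * x $ i + q * y $ i"
          using xy pq by (intro add_mono mult_left_mono) (auto simp: T_def)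
        finally show ?thesis .
      qed
      then show "p *\<^sub>R x + q *\<^sub>R y \<in> T" by (simp add: T_def)
    qed
  qed
  have "convex hull Q \<inter> T \<noteq> {}"
  proof
    assume "convex hull Q \<inter> T = {}"
    moreover have "compact (convex hull Q)" using fin by (simp add: finite_imp_compact_convex_hull)
    moreover have "convex hull Q \<noteq> {}" using \<open>Q \<noteq> {}\<close> by simp
    ultimately obtain a b where ab: "\<And>x. x \<in> convex hull Q \<Longrightarrow> a \<bullet> x < b" "\<And>x. x \<in> T \<Longrightarrow> a \<bullet> x > b"
      using separating_hyperplane_compact_closed[OF convex_convex_hull _ _ T] by metis
    define w :: "real^'n" where "w = (\<chi> i. u i)"
    have w: "w \<in> T" by (simp add: T_def w_def)
    have a_nonneg: "0 \<le> a $ k" for k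
    proof (rule ccontr)
      assume neg: "\<not> 0 \<le> a $ k"
      \<comment> \<open>The length at which moving \<open>w\<close> along axis \<open>k\<close>,
        without leaving \<open>T\<close>, meets the hyperplane.\<close>
      define r where "r = (a \<bullet> w - b) / (- (a $ k))"
      have r: "r \<ge> 0" unfolding r_def using neg ab(2)[OF w] by (intro divide_nonneg_nonneg) auto
      then have "w + r *\<^sub>R axis k 1 \<in> T" by (auto simp: T_def w_def axis_def)
      moreover have "a \<bullet> (w + r *\<^sub>R axis k 1) = b"
        using neg by (simp add: inner_add_right inner_diff_right inner_axis r_def)
      ultimately show False using ab(2) by fastforce
    qed
    obtain \<pi> where \<pi>: "\<pi> permutes UNIV" "\<And>i j. a $ i < a $ j \<Longrightarrow> v (\<pi> i) \<le> v (\<pi> j)"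
      using rearrangement_sorted[of "\<lambda>i. a $ i" v] by blast
    have "(\<chi> i. v (\<pi> i)) \<in> convex hull Q" using \<pi>(1) by (auto simp: Q_def intro: hull_inc)
    from ab(1)[OF this] have "(\<Sum>i\<in>UNIV. a $ i * v (\<pi> i)) < b" by (simp add: inner_vec_def)
    moreover have "b < (\<Sum>i\<in>UNIV. a $ i * u i)" using ab(2)[OF w] by (simp add: inner_vec_def w_def)
    ultimately show False
      using weak_majorization_pairing[of u v "\<lambda>i. a $ i" \<pi>, OF maj a_nonneg \<pi>] by simp
  qed
  then obtain p where p: "p \<in> convex hull Q" "p \<in> T" by blast
  then obtain \<theta> where \<theta>: "\<And>q. q \<in> Q \<Longrightarrow> 0 \<le> \<theta> q" "sum \<theta> Q = 1" "(\<Sum>q\<in>Q. \<theta> q *\<^sub>R q) = p"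
    unfolding convex_hull_finite[OF fin] by blast
  show thesis
  proof (rule that[OF fin])
    show "\<exists>\<pi>. \<pi> permutes UNIV \<and> (\<forall>i. q $ i = v (\<pi> i))" if "q \<in> Q" for q
      using that by (auto simp: Q_def)
    show "u i \<le> (\<Sum>q\<in>Q. \<theta> q * q $ i)" for i
      using p(2) by (simp add: T_def sum_component flip: \<theta>(3))
  qed (use \<theta> in auto)
qed

section \<open>Unitarily invariant norms on diagonal matrices\<close>

context
  fixes N :: "complex^'n^'n \<Rightarrow> real"
  assumes N: "unitarily_invariant_norm N"
begin

lemma ui_norm_triangle: "N (X + Y) \<le> N X + N Y"
  using N by (simp add: unitarily_invariant_norm_def is_matrix_norm_def)

lemma ui_norm_zero: "N 0 = 0"
  using N by (simp add: unitarily_invariant_norm_def is_matrix_norm_def)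

lemma ui_norm_scaleR: "N (c *\<^sub>R X) = \<bar>c\<bar> * N X"
proof -
  have "c *\<^sub>R X = (\<chi> i j. complex_of_real c * X $ i $ j)"
    by (simp add: vec_eq_iff scaleR_conv_of_real[where 'a = complex])
  then show ?thesis using N by (simp add: unitarily_invariant_norm_def is_matrix_norm_def)
qed

lemma ui_norm_unitary: "unitary U \<Longrightarrow> unitary V \<Longrightarrow> N (U ** X ** V) = N X"
  using N by (simp add: unitarily_invariant_norm_def)

lemma ui_norm_sum:
  assumes "finite Q" "\<And>q. q \<in> Q \<Longrightarrow> 0 \<le> \<theta> q"
  shows "N (\<Sum>q\<in>Q. \<theta> q *\<^sub>R X q) \<le> (\<Sum>q\<in>Q. \<theta> q * N (X q))"
  using assms
proof (induction Q)
  case empty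
  then show ?case by (simp add: ui_norm_zero)
next
  case (insert q Q)
  then have "N (\<Sum>q\<in>Q. \<theta> q *\<^sub>R X q) \<le> (\<Sum>q\<in>Q. \<theta> q * N (X q))" "0 \<le> \<theta> q" by simp_all
  then show ?case
    using ui_norm_triangle[of "\<theta> q *\<^sub>R X q" "\<Sum>q\<in>Q. \<theta> q *\<^sub>R X q"] insert.hyps
    by (simp add: ui_norm_scaleR)
qed

lemma ui_norm_spec: "spec X d \<Longrightarrow> N X = N (real_diag d)"
  unfolding spec_def using ui_norm_unitary unitary_adj by metis

lemma ui_norm_permute:
  assumes \<pi>: "\<pi> permutes UNIV"
  shows "N (real_diag (\<lambda>i. d (\<pi> i))) = N (real_diag d)"
proof -
  define P :: "complex^'n^'n" where "P = (\<chi> i j. if j = \<pi> i then 1 else 0)"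
  have inj: "\<pi> i = \<pi> j \<longleftrightarrow> i = j" for i j using permutes_inj[OF \<pi>] by (auto dest: injD)
  have mul: "(P ** M) $ i $ j = M $ \<pi> i $ j" for M i j
    by (simp add: P_def matrix_matrix_mult_def if_distrib if_distribR cong: if_cong)
  have "P ** adj P = mat 1"
    by (simp add: vec_eq_iff mul) (simp add: P_def adj_def mat_def inj)
  then have "unitary (adj P)" by (intro unitaryI) simp
  then have P: "unitary P" using unitary_adj[of "adj P"] by simp
  have "P ** real_diag d = real_diag (\<lambda>i. d (\<pi> i)) ** P"
    by (simp add: vec_eq_iff mul real_diag_mult_nth) (simp add: P_def real_diag_nth)
  then have "P ** real_diag d ** adj P = real_diag (\<lambda>i. d (\<pi> i))"
    by (simp add: unitaryD[OF P])
  then show ?thesis using ui_norm_unitary[OF P unitary_adj[OF P], of "real_diag d"] by simp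
qed

text \<open>\<open>x k\<close> is a convex combination of \<open>w\<close> and \<open>-w\<close>,
  and the two diagonal matrices with these entries have equal norm, since a diagonal sign matrix
  \<open>F\<close> exchanges them.\<close>

lemma ui_norm_diag_update:
  assumes "\<bar>x k\<bar> \<le> w"
  shows "N (real_diag x) \<le> N (real_diag (x(k := w)))"
proof (cases "w = 0")
  case True
  then show ?thesis using assms by (simp add: fun_upd_idem)
next
  case False
  then have w: "w > 0" using assms by auto
  define s where "s = (1 + x k / w) / 2"
  have s: "0 \<le> s" "s \<le> 1" "s * w + (1 - s) * (- w) = x k"
    using assms w by (auto simp: s_def field_simps abs_le_iff)
  define F :: "complex^'n^'n" where "F = real_diag (\<lambda>i. if i = k then -1 else 1)"
  have "F ** F = mat 1" unfolding F_def real_diag_mult real_diag_1[symmetric] by (rule arg_cong[where f = real_diag]) auto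
  then have F: "unitary F" by (intro unitaryI) (simp add: F_def)
  have flip: "N (real_diag (x(k := - w))) = N (real_diag (x(k := w)))"
  proof -
    have "F ** real_diag (x(k := w)) ** mat 1 = real_diag (x(k := - w))"
      unfolding F_def matrix_mul_rid real_diag_mult by (rule arg_cong[where f = real_diag]) auto
    then show ?thesis using ui_norm_unitary[OF F unitary_mat_1, of "real_diag (x(k := w))"] by simp
  qed
  have "real_diag x = s *\<^sub>R real_diag (x(k := w)) + (1 - s) *\<^sub>R real_diag (x(k := - w))"
    unfolding real_diag_scaleR real_diag_add
    by (rule arg_cong[where f = real_diag]) (use s(3) in \<open>auto simp: fun_eq_iff algebra_simps\<close>)
  then have "N (real_diag x) \<le> s * N (real_diag (x(k := w))) + (1 - s) * N (real_diag (x(k := - w)))"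
    using ui_norm_triangle[of "s *\<^sub>R real_diag (x(k := w))" "(1 - s) *\<^sub>R real_diag (x(k := - w))"] s(1,2)
    by (simp add: ui_norm_scaleR)
  then show ?thesis unfolding flip by (simp add: algebra_simps)
qed

lemma ui_norm_diag_mono:
  assumes "\<And>i. \<bar>x i\<bar> \<le> w i"
  shows "N (real_diag x) \<le> N (real_diag w)"
proof -
  have "N (real_diag x) \<le> N (real_diag (\<lambda>i. if i \<in> S then w i else x i))" if "finite S" for S
    using that
  proof (induction S)
    case (insert k S)
    let ?y = "\<lambda>i. if i \<in> S then w i else x i"
    have "N (real_diag ?y) \<le> N (real_diag (?y(k := w k)))"
      using insert.hyps(2) assms[of k] by (intro ui_norm_diag_update) simp
    also have "?y(k := w k) = (\<lambda>i. if i \<in> insert k S then w i else x i)" by auto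
    finally show ?case using insert.IH by simp
  qed simp
  from this[of UNIV] show ?thesis by simp
qed

text \<open>The common core of both majorization principles: \<open>f\<close> is the identity for
  spectra and \<open>exp\<close> for their logarithms.\<close>

lemma ui_norm_le_of_hull:
  assumes Q: "finite Q" "\<And>q. q \<in> Q \<Longrightarrow> \<exists>\<pi>. \<pi> permutes UNIV \<and> (\<forall>i. q $ i = v (\<pi> i))"
    and \<theta>: "\<And>q. q \<in> Q \<Longrightarrow> 0 \<le> \<theta> q" "sum \<theta> Q = 1"
    and x: "\<And>i. 0 \<le> x i" "\<And>i. x i \<le> (\<Sum>q\<in>Q. \<theta> q * f (q $ i))"
  shows "N (real_diag x) \<le> N (real_diag (\<lambda>i. f (v i)))"
proof -
  have "N (real_diag x) \<le> N (real_diag (\<lambda>i. \<Sum>q\<in>Q. \<theta> q * f (q $ i)))"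
    using x by (intro ui_norm_diag_mono) simp
  also have "real_diag (\<lambda>i. \<Sum>q\<in>Q. \<theta> q * f (q $ i)) = (\<Sum>q\<in>Q. \<theta> q *\<^sub>R real_diag (\<lambda>i. f (q $ i)))"
    by (simp add: vec_eq_iff sum_component real_diag_nth scaleR_conv_of_real[where 'a = complex])
  also have "N \<dots> \<le> (\<Sum>q\<in>Q. \<theta> q * N (real_diag (\<lambda>i. f (q $ i))))"
    by (rule ui_norm_sum[OF Q(1) \<theta>(1)])
  also have "\<dots> = (\<Sum>q\<in>Q. \<theta> q * N (real_diag (\<lambda>i. f (v i))))"
  proof (intro sum.cong refl)
    fix q assume "q \<in> Q"
    then obtain \<pi> where \<pi>: "\<pi> permutes UNIV" "\<And>i. q $ i = v (\<pi> i)" using Q(2) by blast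
    then show "\<theta> q * N (real_diag (\<lambda>i. f (q $ i))) = \<theta> q * N (real_diag (\<lambda>i. f (v i)))"
      using ui_norm_permute[OF \<pi>(1), of "\<lambda>i. f (v i)"] by simp
  qed
  finally show ?thesis using \<theta>(2) by (simp flip: sum_distrib_right)
qed

lemma ui_norm_weak_majorization:
  assumes maj: "\<And>c. (\<Sum>i\<in>UNIV. max 0 (x i - c)) \<le> (\<Sum>i\<in>UNIV. max 0 (y i - c))"
    and x: "\<And>i. 0 \<le> x i"
  shows "N (real_diag x) \<le> N (real_diag y)"
proof -
  obtain Q :: "(real^'n) set" and \<theta> where Q: "finite Q" "\<And>q. q \<in> Q \<Longrightarrow> \<exists>\<pi>. \<pi> permutes UNIV \<and> (\<forall>i. q $ i = y (\<pi> i))"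
    "\<And>q. q \<in> Q \<Longrightarrow> 0 \<le> \<theta> q" "sum \<theta> Q = 1" "\<And>i. x i \<le> (\<Sum>q\<in>Q. \<theta> q * q $ i)"
    using weak_majorization_hull[of x y, OF maj] by blast
  show ?thesis using ui_norm_le_of_hull[where f = "\<lambda>x. x", OF Q(1-4) x Q(5)] by simp
qed

lemma ui_norm_weak_log_majorization:
  assumes maj: "\<And>c. (\<Sum>i\<in>UNIV. max 0 (x i - c)) \<le> (\<Sum>i\<in>UNIV. max 0 (y i - c))"
  shows "N (real_diag (\<lambda>i. exp (x i))) \<le> N (real_diag (\<lambda>i. exp (y i)))"
proof -
  obtain Q :: "(real^'n) set" and \<theta> where Q: "finite Q" "\<And>q. q \<in> Q \<Longrightarrow> \<exists>\<pi>. \<pi> permutes UNIV \<and> (\<forall>i. q $ i = y (\<pi> i))"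
    "\<And>q. q \<in> Q \<Longrightarrow> 0 \<le> \<theta> q" "sum \<theta> Q = 1" "\<And>i. x i \<le> (\<Sum>q\<in>Q. \<theta> q * q $ i)"
    using weak_majorization_hull[of x y, OF maj] by blast
  \<comment> \<open>Jensen's inequality for \<open>exp\<close> moves the convex combination
    outside.\<close>
  have "exp (x i) \<le> (\<Sum>q\<in>Q. \<theta> q * exp (q $ i))" for i
  proof -
    have "exp (x i) \<le> exp (\<Sum>q\<in>Q. \<theta> q *\<^sub>R (q $ i))" using Q(5)[of i] by simp
    also have "\<dots> \<le> (\<Sum>q\<in>Q. \<theta> q * exp (q $ i))"
      by (rule convex_on_sum[OF Q(1) _ exp_convex Q(4,3)]) (use Q(4) in auto)
    finally show ?thesis .
  qed
  then show ?thesis by (intro ui_norm_le_of_hull[OF Q(1-4)]) auto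
qed

text \<open>The singular value decomposition \<open>Z = W diag(sqrt e) adj V\<close> shows that the
  norm sees only the singular values; the adjoint has the same middle factor.\<close>

lemma ui_norm_singular_values:
  assumes inv: "L ** Z = mat 1" and e: "spec (adj Z ** Z) e"
  shows "N Z = N (real_diag (\<lambda>i. sqrt (e i)))" "N (adj Z) = N (real_diag (\<lambda>i. sqrt (e i)))"
proof -
  have "pos_def (adj Z ** Z)"
    using pos_def_cong[OF pos_def_real_diag[of "\<lambda>_. 1"] inv] by (simp add: real_diag_1)
  then have pos: "e i > 0" for i using spec_pos_def[OF e] by simp
  then have nz: "e i \<noteq> 0" for i by (metis less_irrefl)
  obtain V where V: "unitary V" "adj Z ** Z = V ** real_diag e ** adj V" using e by (auto simp: spec_def)
  define W where "W = Z ** V ** real_diag (\<lambda>i. 1 / sqrt (e i))"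
  have "adj W ** W = real_diag (\<lambda>i. 1 / sqrt (e i)) ** adj V ** (adj Z ** Z) ** V ** real_diag (\<lambda>i. 1 / sqrt (e i))"
    by (simp add: W_def adj_mult matrix_mul_assoc)
  also have "\<dots> = real_diag (\<lambda>i. 1 / sqrt (e i) * e i * (1 / sqrt (e i)))"
    unfolding V(2) by (simp add: matrix_mul_assoc unitaryD[OF V(1)] real_diag_mult)
  also have "(\<lambda>i. 1 / sqrt (e i) * e i * (1 / sqrt (e i))) = (\<lambda>i. 1)"
  proof
    fix i
    have "sqrt (e i) * sqrt (e i) = e i" using pos[of i] by simp
    then show "1 / sqrt (e i) * e i * (1 / sqrt (e i)) = 1" using nz[of i] by (simp add: field_simps)
  qed
  finally have W: "unitary W" by (intro unitaryI) (simp add: real_diag_1)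
  have "W ** real_diag (\<lambda>i. sqrt (e i)) = Z ** V ** real_diag (\<lambda>i. 1 / sqrt (e i) * sqrt (e i))"
    by (simp add: W_def real_diag_mult flip: matrix_mul_assoc)
  also have "\<dots> = Z ** V" using nz by (simp add: real_diag_1)
  finally have Z: "Z = W ** real_diag (\<lambda>i. sqrt (e i)) ** adj V" by (simp add: unitaryD[OF V(1)])
  show "N Z = N (real_diag (\<lambda>i. sqrt (e i)))"
    by (subst Z) (rule ui_norm_unitary[OF W unitary_adj[OF V(1)]])
  have "adj Z = V ** real_diag (\<lambda>i. sqrt (e i)) ** adj W"
    by (subst Z) (simp add: adj_mult matrix_mul_assoc)
  then show "N (adj Z) = N (real_diag (\<lambda>i. sqrt (e i)))"
    using ui_norm_unitary[OF V(1) unitary_adj[OF W]] by simp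
qed

lemma ui_norm_adj:
  assumes "L ** Z = mat 1"
  shows "N (adj Z) = N Z"
proof -
  have "hermitian (adj Z ** Z)" by (simp add: hermitian_def adj_mult)
  then obtain e where "spec (adj Z ** Z) e" using hermitian_spec by blast
  from ui_norm_singular_values[OF assms this] show ?thesis by simp
qed

end

section \<open>The chain of norm inequalities\<close>

lemma spec_mat_exp: "spec L l \<Longrightarrow> spec (mat_exp L) (\<lambda>i. exp (l i))"
  unfolding spec_def using mat_exp_eq by blast

lemma mat_ln_exp_scale:
  assumes "pos_def A"
  shows "mat_ln (exp c *\<^sub>R A) = mat_ln A + c *\<^sub>R mat 1"
  using mat_ln_scaleR[OF assms, of "exp c"] by (simp add: add.commute)

text \<open>Scaling by \<open>exp (- c)\<close> shifts logarithms by \<open>- c\<close>, so bounds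
  at threshold \<open>1\<close>, once known for all matrices, yield every threshold.\<close>

lemma ln_spec_scale:
  assumes "spec X x" "pos_def X"
  shows "trace_fun ln_plus (exp (- c) *\<^sub>R X) = (\<Sum>i\<in>UNIV. max 0 (ln (x i) - c))"
proof -
  have "x i > 0" for i using spec_pos_def assms by blast
  then have "x i \<noteq> 0" for i by (metis less_irrefl)
  then show ?thesis by (simp add: trace_fun_spec[OF spec_scaleR[OF assms(1)]] ln_mult)
qed

lemma geo_mean_log_majorized:
  fixes A B :: "complex^'n^'n"
  assumes A: "pos_def A" and B: "pos_def B" and t: "0 \<le> t" "t \<le> 1"
    and x: "spec (geo_mean A t B) x" and l: "spec ((1 - t) *\<^sub>R mat_ln A + t *\<^sub>R mat_ln B) l"
  shows "(\<Sum>i\<in>UNIV. max 0 (ln (x i) - c)) \<le> (\<Sum>i\<in>UNIV. max 0 (l i - c))"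
proof -
  have sc: "pos_def (exp (- c) *\<^sub>R A)" "pos_def (exp (- c) *\<^sub>R B)" using A B by (auto intro: pos_def_scaleR)
  have "(1 - t) *\<^sub>R mat_ln (exp (- c) *\<^sub>R A) + t *\<^sub>R mat_ln (exp (- c) *\<^sub>R B)
      = 1 *\<^sub>R ((1 - t) *\<^sub>R mat_ln A + t *\<^sub>R mat_ln B) + (- c) *\<^sub>R mat 1"
    unfolding mat_ln_exp_scale[OF A] mat_ln_exp_scale[OF B] by (simp add: algebra_simps)
  then have "spec ((1 - t) *\<^sub>R mat_ln (exp (- c) *\<^sub>R A) + t *\<^sub>R mat_ln (exp (- c) *\<^sub>R B)) (\<lambda>i. 1 * l i + - c)"
    using spec_shift[OF l, of 1 "- c"] by simp
  from ln_plus_geo_mean_le[OF sc t this] show ?thesis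
    by (simp add: geo_mean_scaleR[OF A B] ln_spec_scale[OF x pos_def_geo_mean[OF A B]])
qed

text \<open>Scaling \<open>X\<close> alone by \<open>exp (- c)\<close> shifts both sides by
  \<open>- c\<close>.\<close>

lemma exp_log_majorized:
  fixes X Y :: "complex^'n^'n"
  assumes X: "pos_def X" and Y: "pos_def Y" and l: "spec (mat_ln X + 2 *\<^sub>R mat_ln Y) l"
    and m: "spec (Y ** X ** Y) m"
  shows "(\<Sum>i\<in>UNIV. max 0 (l i - c)) \<le> (\<Sum>i\<in>UNIV. max 0 (ln (m i) - c))"
proof -
  have eq: "mat_ln (exp (- c) *\<^sub>R X) + 2 *\<^sub>R mat_ln Y = 1 *\<^sub>R (mat_ln X + 2 *\<^sub>R mat_ln Y) + (- c) *\<^sub>R mat 1"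
    unfolding mat_ln_exp_scale[OF X] by (simp add: algebra_simps)
  have "spec (mat_ln (exp (- c) *\<^sub>R X) + 2 *\<^sub>R mat_ln Y) (\<lambda>i. 1 * l i + - c)"
    unfolding eq by (rule spec_shift[OF l])
  from ln_sum_le_sandwich[OF pos_def_scaleR[OF X] Y this]
  have "(\<Sum>i\<in>UNIV. max 0 (1 * l i + - c)) \<le> trace_fun ln_plus (Y ** (exp (- c) *\<^sub>R X) ** Y)" by simp
  also have "Y ** (exp (- c) *\<^sub>R X) ** Y = exp (- c) *\<^sub>R (Y ** X ** Y)" by (simp add: matrix_mult_distribs)
  finally show ?thesis by (simp add: ln_spec_scale[OF m pos_def_cong_hermitian[OF X Y]])
qed

lemma ui_norm_young:
  fixes A B :: "complex^'n^'n" and N :: "complex^'n^'n \<Rightarrow> real"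
  assumes N: "unitarily_invariant_norm N" and A: "pos_def A" and B: "pos_def B" and t: "1/2 \<le> t" "t \<le> 1"
  shows "N (mat_powr A (1 - t) ** mat_powr B t) \<le> N ((1 - t) *\<^sub>R A + t *\<^sub>R B)"
proof -
  define Z where "Z = mat_powr A (1 - t) ** mat_powr B t"
  have inv: "(mat_powr B (- t) ** mat_powr A (- (1 - t))) ** Z = mat 1"
  proof -
    have "(mat_powr B (- t) ** mat_powr A (- (1 - t))) ** Z
        = mat_powr B (- t) ** (mat_powr A (- (1 - t)) ** mat_powr A (1 - t)) ** mat_powr B t"
      by (simp add: Z_def matrix_mul_assoc)
    then show ?thesis unfolding mat_powr_inverse(2)[OF A] by (simp add: mat_powr_inverse(2)[OF B])
  qed
  have ZZ: "adj Z ** Z = mat_powr B t ** mat_powr A (2 - 2 * t) ** mat_powr B t"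
  proof -
    have "adj Z ** Z = mat_powr B t ** (mat_powr A (1 - t) ** mat_powr A (1 - t)) ** mat_powr B t"
      using mat_powr_hermitian[OF A] mat_powr_hermitian[OF B]
      by (simp add: Z_def adj_mult hermitian_def matrix_mul_assoc)
    then show ?thesis by (simp add: mat_powr_mult[OF A])
  qed
  have pZ: "pos_def (adj Z ** Z)" unfolding ZZ by (intro pos_def_cong_hermitian mat_powr_pos_def A B)
  obtain e where e: "spec (adj Z ** Z) e" using hermitian_spec pos_def_hermitian[OF pZ] by blast
  have e_pos: "e i > 0" for i using spec_pos_def[OF e] pZ by simp
  have "hermitian ((1 - t) *\<^sub>R A + t *\<^sub>R B)"
    by (intro hermitian_add hermitian_scaleR pos_def_hermitian A B)
  then obtain \<mu> where \<mu>: "spec ((1 - t) *\<^sub>R A + t *\<^sub>R B) \<mu>" using hermitian_spec by blast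
  have "N (real_diag (\<lambda>i. sqrt (e i))) \<le> N (real_diag \<mu>)"
  proof (rule ui_norm_weak_majorization[OF N])
    fix c
    show "(\<Sum>i\<in>UNIV. max 0 (sqrt (e i) - c)) \<le> (\<Sum>i\<in>UNIV. max 0 (\<mu> i - c))"
    proof (rule young_singular_values[OF A B t _ _ \<mu>])
      show "spec (mat_powr B t ** mat_powr A (2 - 2 * t) ** mat_powr B t) (\<lambda>i. (sqrt (e i))\<^sup>2)"
        using e e_pos by (simp add: ZZ less_imp_le)
    qed (simp add: e_pos)
  qed (use e_pos in \<open>simp add: less_imp_le\<close>)
  then show ?thesis
    using ui_norm_singular_values(1)[OF N inv e] ui_norm_spec[OF N \<mu>] by (simp add: Z_def)
qed

theorem theorem3:
  fixes A B :: "complex^'n^'n" and t :: real and N :: "complex^'n^'n \<Rightarrow> real"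
  assumes "pos_def A" and "pos_def B" and "0 \<le> t" and "t \<le> 1"
    and "unitarily_invariant_norm N"
  shows "N (geo_mean A t B) \<le> N (mat_exp ((1 - t) *\<^sub>R mat_ln A + t *\<^sub>R mat_ln B))
    \<and> N (mat_exp ((1 - t) *\<^sub>R mat_ln A + t *\<^sub>R mat_ln B))
        \<le> N (mat_powr B (t / 2) ** mat_powr A (1 - t) ** mat_powr B (t / 2))
    \<and> N (mat_powr B (t / 2) ** mat_powr A (1 - t) ** mat_powr B (t / 2))
        \<le> N ((1 / 2) *\<^sub>R (mat_powr A (1 - t) ** mat_powr B t + mat_powr B t ** mat_powr A (1 - t)))
    \<and> N ((1 / 2) *\<^sub>R (mat_powr A (1 - t) ** mat_powr B t + mat_powr B t ** mat_powr A (1 - t)))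
        \<le> N (mat_powr A (1 - t) ** mat_powr B t)
    \<and> N (mat_powr A (1 - t) ** mat_powr B t) \<le> N ((1 - t) *\<^sub>R A + t *\<^sub>R B)"
proof (intro conjI)
  note A = assms(1) and B = assms(2) and t = assms(3,4) and N = assms(5)
  \<comment> \<open>The three middle inequalities involve only \<open>X\<close> and
    \<open>S = Y^2\<close>; in these terms the exponent is \<open>L = ln X + 2 ln Y\<close>.\<close>
  define X S Y where "X = mat_powr A (1 - t)" and "S = mat_powr B t" and "Y = mat_powr B (t / 2)"
  have X: "pos_def X" and S: "pos_def S" and Y: "pos_def Y"
    by (simp_all add: X_def S_def Y_def mat_powr_pos_def A B)
  have Y_eq: "Y = mat_powr S (1/2)" by (simp add: Y_def S_def mat_powr_powr[OF B])
  define L where "L = (1 - t) *\<^sub>R mat_ln A + t *\<^sub>R mat_ln B"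
  have "hermitian L"
    unfolding L_def by (intro hermitian_add hermitian_scaleR mat_ln_hermitian A B)
  then obtain l where l: "spec L l" using hermitian_spec by blast
  have G: "pos_def (geo_mean A t B)" by (rule pos_def_geo_mean[OF A B])
  then obtain x where x: "spec (geo_mean A t B) x" using hermitian_spec pos_def_hermitian by blast
  have x_pos: "x i > 0" for i using spec_pos_def[OF x] G by simp
  have M: "pos_def (Y ** X ** Y)" by (rule pos_def_cong_hermitian[OF X Y])
  then obtain m where m: "spec (Y ** X ** Y) m" using hermitian_spec pos_def_hermitian by blast
  have m_pos: "m i > 0" for i using spec_pos_def[OF m] M by simp
  have "adj X = X" "adj S = S" using pos_def_hermitian X S by (simp_all add: hermitian_def)
  then have adj_XS: "adj (X ** S) = S ** X" by (simp add: adj_mult)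
  then have "hermitian ((1/2) *\<^sub>R (X ** S + S ** X))"
    by (intro hermitian_scaleR) (simp add: hermitian_def adj_add adj_mult \<open>adj X = X\<close> \<open>adj S = S\<close> add.commute)
  then obtain h where h: "spec ((1/2) *\<^sub>R (X ** S + S ** X)) h" using hermitian_spec by blast
  have N_exp: "N (mat_exp L) = N (real_diag (\<lambda>i. exp (l i)))" by (rule ui_norm_spec[OF N spec_mat_exp[OF l]])
  have inv: "(mat_powr S (-1) ** mat_powr X (-1)) ** (X ** S) = mat 1"
  proof -
    have "(mat_powr S (-1) ** mat_powr X (-1)) ** (X ** S) = mat_powr S (-1) ** (mat_powr X (-1) ** mat_powr X 1) ** mat_powr S 1"
      by (simp add: matrix_mul_assoc mat_powr_1 X S)
    then show ?thesis unfolding mat_powr_inverse(2)[OF X] by (simp add: mat_powr_inverse(2)[OF S])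
  qed

  have "N (real_diag (\<lambda>i. exp (ln (x i)))) \<le> N (real_diag (\<lambda>i. exp (l i)))"
    by (rule ui_norm_weak_log_majorization[OF N]) (rule geo_mean_log_majorized[OF A B t x l[unfolded L_def]])
  then show "N (geo_mean A t B) \<le> N (mat_exp ((1 - t) *\<^sub>R mat_ln A + t *\<^sub>R mat_ln B))"
    using ui_norm_spec[OF N x] x_pos by (simp add: N_exp flip: L_def)

  have "mat_ln X + 2 *\<^sub>R mat_ln Y = L"
    by (simp add: X_def Y_def L_def mat_ln_powr A B)
  then have "N (real_diag (\<lambda>i. exp (l i))) \<le> N (real_diag (\<lambda>i. exp (ln (m i))))"
    using l by (intro ui_norm_weak_log_majorization[OF N] exp_log_majorized[OF X Y _ m]) simp
  then show "N (mat_exp ((1 - t) *\<^sub>R mat_ln A + t *\<^sub>R mat_ln B))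
      \<le> N (mat_powr B (t / 2) ** mat_powr A (1 - t) ** mat_powr B (t / 2))"
    using ui_norm_spec[OF N m] m_pos by (simp add: N_exp flip: L_def X_def Y_def)

  have "N (real_diag m) \<le> N (real_diag h)"
    using m_pos
    by (intro ui_norm_weak_majorization[OF N] sandwich_majorized_real_part[OF pos_def_hermitian[OF X] S _ h])
      (simp_all add: m less_imp_le flip: Y_eq)
  then show "N (mat_powr B (t / 2) ** mat_powr A (1 - t) ** mat_powr B (t / 2))
      \<le> N ((1 / 2) *\<^sub>R (mat_powr A (1 - t) ** mat_powr B t + mat_powr B t ** mat_powr A (1 - t)))"
    unfolding X_def[symmetric] Y_def[symmetric] S_def[symmetric]
    by (simp add: ui_norm_spec[OF N m] ui_norm_spec[OF N h])

  have N_adj: "N (S ** X) = N (X ** S)" using ui_norm_adj[OF N inv] by (simp add: adj_XS)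
  have "N ((1/2) *\<^sub>R (X ** S + S ** X)) \<le> N (X ** S)"
    using ui_norm_triangle[OF N, of "X ** S" "S ** X"] by (simp add: ui_norm_scaleR[OF N] N_adj)
  then show "N ((1 / 2) *\<^sub>R (mat_powr A (1 - t) ** mat_powr B t + mat_powr B t ** mat_powr A (1 - t)))
      \<le> N (mat_powr A (1 - t) ** mat_powr B t)"
    by (simp only: X_def S_def)

  show "N (mat_powr A (1 - t) ** mat_powr B t) \<le> N ((1 - t) *\<^sub>R A + t *\<^sub>R B)"
  proof (cases "1/2 \<le> t")
    case True
    then show ?thesis using ui_norm_young[OF N A B _ t(2)] by simp
  next
    \<comment> \<open>With \<open>A\<close> and \<open>B\<close> exchanged the exponent is
      \<open>1 - t \<ge> 1/2\<close>; the product obtained is the adjoint of the required one and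
      has the same norm.\<close>
    case False
    then have "N (S ** X) \<le> N (t *\<^sub>R B + (1 - t) *\<^sub>R A)"
      using ui_norm_young[OF N B A, of "1 - t"] t by (simp add: X_def S_def)
    then show ?thesis using N_adj by (simp add: X_def S_def add.commute)
  qed
qed

end
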